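(* Let $E$ and $F$ be (normed) $PL$-spaces. Then the pair $(E\otimes_{l}F,\vartheta)$, where $\vartheta:E\times F\to E\otimes_{l}F,\ (x,y)\mapsto x\otimes y$ is the canonical bilinear operator, is a non-completed $L$-tensor product of $E$ and $F$. That is: $E\otimes_{l}F$ is a normed $L$-space, $\vartheta$ is $L$-contractive, and for every normed $L$-space $G$ and every $L$-bounded bilinear operator $\mathcal{R}:E\times F\to G$ there exists a unique $L$-bounded linear operator $R:E\otimes_{l}F\to G$ such that $R\circ\vartheta=\mathcal{R}$, and moreover $\|R\|_{lb}=\|\mathcal{R}\|_{lb}$.
   Context: All linear spaces are complex. $H$ is a fixed separable infinite-dimensional Hilbert space, $\mathcal{B}$ is the algebra of bounded operators on $H$ with the operator norm. For a linear space $E$, $HE:=H\otimes E$ (algebraic tensor product), with elementary tensors written $\xi x$; it is a left $\mathcal{B}$-module via $a\cdot(\xi x):=a(\xi)x$. A (normed) $PL$-space is a linear space $E$ together with a norm on $HE$ (the $PL$-norm) such that $\|a\cdot u\|\le\|a\|\|u\|$ for all $a\in\mathcal{B}$, $u\in HE$. An (orthogonal) projection $P\in\mathcal{B}$ is a support of $u\in HE$ if $P\cdot u=u$. A (normed) $L$-space is a $PL$-space $E$ such that $\|u+v\|^2\le\|u\|^2+\|v\|^2$ whenever $u,v\in HE$ have orthogonal supports. A linear operator $\varphi:E\to F$ has amplification $\varphi_\infty:HE\to HF,\ \xi x\mapsto\xi\varphi(x)$; between $PL$-spaces, $\varphi$ is $L$-bounded if $\varphi_\infty$ is bounded, and $\|\varphi\|_{lb}:=\|\varphi_\infty\|$.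 Fix a unitary isomorphism $\iota$ from the Hilbert tensor product $H\widehat\otimes_{hil}H$ onto $H$, and put $\xi\diamondsuit\eta:=\iota(\xi\otimes\eta)$. A bilinear operator $\mathcal{R}:E\times F\to G$ has amplification $\mathcal{R}_\infty:HE\times HF\to HG$, well defined by $\mathcal{R}_\infty(\xi x,\eta y)=(\xi\diamondsuit\eta)\mathcal{R}(x,y)$; between $PL$-spaces, $\mathcal{R}$ is $L$-bounded (resp. $L$-contractive) if $\mathcal{R}_\infty$ is bounded (resp. contractive), and $\|\mathcal{R}\|_{lb}:=\|\mathcal{R}_\infty\|$. For $u\in HE$, $v\in HF$ the element $u\diamondsuit v\in H(E\otimes F)$ is well defined bilinearly by $\xi x\diamondsuit\eta y:=(\xi\diamondsuit\eta)(x\otimes y)$. $E\otimes_{l}F$ is the linear space $E\otimes F$ equipped with the function on $H(E\otimes F)$ $$\|U\|_{l}:=\inf\Big\{\|a\|\Big(\sum_{k=1}^n\|u_k\|^2\|v_k\|^2\Big)^{1/2}\Big\},$$ the infimum being over all representations $U=a\cdot\big(\sum_{k=1}^n u_k\diamondsuit v_k\big)$ with $n\in\mathbb{N}$, $a\in\mathcal{B}$, $u_k\in HE$, $v_k\in HF$, where the $u_k$ have pairwise orthogonal supports (such representations always exist). *)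

theory Defs
  imports "HOL-Analysis.Analysis" "HOL-Library.Poly_Mapping"
begin

section \<open>Complex linear spaces and Hilbert spaces\<close>

class complex_vector = ab_group_add +
  fixes scaleC :: "complex \<Rightarrow> 'a \<Rightarrow> 'a"  (infixr "*\<^sub>C" 75)
  assumes scaleC_add_right: "a *\<^sub>C (x + y) = a *\<^sub>C x + a *\<^sub>C y"
    and scaleC_add_left: "(a + b) *\<^sub>C x = a *\<^sub>C x + b *\<^sub>C x"
    and scaleC_scaleC: "a *\<^sub>C (b *\<^sub>C x) = (a * b) *\<^sub>C x"
    and scaleC_one: "1 *\<^sub>C x = x"

global_interpretation complex_vector: vector_space "scaleC :: complex \<Rightarrow> 'a \<Rightarrow> 'a::complex_vector"
  defines cspan = complex_vector.span
  by unfold_locales (simp_all add: scaleC_add_right scaleC_add_left scaleC_scaleC scaleC_one)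

abbreviation clinear :: "('a::complex_vector \<Rightarrow> 'b::complex_vector) \<Rightarrow> bool"
  where "clinear \<equiv> Vector_Spaces.linear (*\<^sub>C) (*\<^sub>C)"

definition cbilinear ::
    "('a::complex_vector \<Rightarrow> 'b::complex_vector \<Rightarrow> 'c::complex_vector) \<Rightarrow> bool"
  where "cbilinear B \<longleftrightarrow> (\<forall>x. clinear (\<lambda>y. B x y)) \<and> (\<forall>y. clinear (\<lambda>x. B x y))"

text \<open>The complex inner product is linear in the first argument.  The norm, the metric and the
  topology are those of \<^class>\<open>real_inner\<close>, and its real inner product is the real part of
  the complex one.\<close>

class complex_inner = complex_vector + real_inner +
  fixes cinner :: "'a \<Rightarrow> 'a \<Rightarrow> complex"
  assumes scaleR_scaleC: "r *\<^sub>R x = complex_of_real r *\<^sub>C x"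
    and cinner_add_left: "cinner (x + y) z = cinner x z + cinner y z"
    and cinner_scaleC_left: "cinner (c *\<^sub>C x) y = c * cinner x y"
    and cinner_commute: "cinner x y = cnj (cinner y x)"
    and inner_eq_Re_cinner: "x \<bullet> y = Re (cinner x y)"

class complex_hilbert = complex_inner + complete_space

instantiation complex :: complex_hilbert
begin

definition scaleC_complex :: "complex \<Rightarrow> complex \<Rightarrow> complex"
  where "scaleC_complex = (*)"

definition cinner_complex :: "complex \<Rightarrow> complex \<Rightarrow> complex"
  where "cinner_complex x y = x * cnj y"

instance
  by standard
    (simp_all add: scaleC_complex_def cinner_complex_def algebra_simps scaleR_conv_of_real
      inner_complex_def)

end

instantiation poly_mapping :: (type, complex_vector) complex_vector
begin

lift_definition scaleC_poly_mapping :: "complex \<Rightarrow> ('a \<Rightarrow>\<^sub>0 'b) \<Rightarrow> ('a \<Rightarrow>\<^sub>0 'b)"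
  is "\<lambda>c f k. c *\<^sub>C f k"
proof -
  fix c :: complex and f :: "'a \<Rightarrow> 'b"
  assume "finite {k. f k \<noteq> 0}"
  then show "finite {k. c *\<^sub>C f k \<noteq> 0}"
    by (rule rev_finite_subset) auto
qed

instance
  by standard (transfer; simp add: scaleC_add_right scaleC_add_left scaleC_scaleC scaleC_one)+

end

lemma lookup_scaleC:
  "Poly_Mapping.lookup (c *\<^sub>C f) k = c *\<^sub>C Poly_Mapping.lookup f k"
  by transfer simp


section \<open>The algebraic tensor product\<close>

text \<open>The type of finitely supported functions from pairs to the complex numbers is the free
  linear space on the set of pairs.  The tensor product is its quotient by the subspace spanned
  by the bilinearity relations.\<close>

abbreviation pair_gen :: "'a \<Rightarrow> 'b \<Rightarrow> ('a \<times> 'b \<Rightarrow>\<^sub>0 complex)"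
  where "pair_gen x y \<equiv> Poly_Mapping.single (x, y) 1"

definition bilinear_relators :: "('a::complex_vector \<times> 'b::complex_vector \<Rightarrow>\<^sub>0 complex) set"
  where "bilinear_relators =
    {pair_gen (x + x') y - pair_gen x y - pair_gen x' y | x x' y. True} \<union>
    {pair_gen x (y + y') - pair_gen x y - pair_gen x y' | x y y'. True} \<union>
    {pair_gen (c *\<^sub>C x) y - c *\<^sub>C pair_gen x y | c x y. True} \<union>
    {pair_gen x (c *\<^sub>C y) - c *\<^sub>C pair_gen x y | c x y. True}"

definition tensor_rel ::
    "('a::complex_vector \<times> 'b::complex_vector \<Rightarrow>\<^sub>0 complex) \<Rightarrow> ('a \<times> 'b \<Rightarrow>\<^sub>0 complex) \<Rightarrow> bool"
  where "tensor_rel f g \<longleftrightarrow> f - g \<in> cspan bilinear_relators"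

lemma equivp_tensor_rel:
  "equivp (tensor_rel ::
    ('a::complex_vector \<times> 'b::complex_vector \<Rightarrow>\<^sub>0 complex) \<Rightarrow> _ \<Rightarrow> bool)"
proof (rule equivpI)
  show "reflp tensor_rel"
    by (simp add: reflp_def tensor_rel_def complex_vector.span_zero)
  show "symp tensor_rel"
    unfolding symp_def tensor_rel_def
    by (metis complex_vector.span_neg minus_diff_eq)
  show "transp tensor_rel"
    unfolding transp_def tensor_rel_def
    by (metis (no_types) complex_vector.span_add diff_add_cancel diff_add_eq add_diff_eq)
qed

quotient_type (overloaded) ('a, 'b) tensor =
    "('a::complex_vector \<times> 'b::complex_vector) \<Rightarrow>\<^sub>0 complex" / tensor_rel
  by (rule equivp_tensor_rel)

instantiation tensor :: (complex_vector, complex_vector) complex_vector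
begin

lift_definition zero_tensor :: "('a, 'b) tensor" is "0" .

lift_definition plus_tensor :: "('a, 'b) tensor \<Rightarrow> ('a, 'b) tensor \<Rightarrow> ('a, 'b) tensor" is "(+)"
  unfolding tensor_rel_def by (metis add_diff_add complex_vector.span_add)

lift_definition uminus_tensor :: "('a, 'b) tensor \<Rightarrow> ('a, 'b) tensor" is "uminus"
  unfolding tensor_rel_def by (metis complex_vector.span_neg minus_diff_minus)

lift_definition minus_tensor :: "('a, 'b) tensor \<Rightarrow> ('a, 'b) tensor \<Rightarrow> ('a, 'b) tensor" is "(-)"
  unfolding tensor_rel_def
proof -
  fix f g f' g' :: "('a \<times> 'b) \<Rightarrow>\<^sub>0 complex"
  assume "f - g \<in> cspan bilinear_relators" "f' - g' \<in> cspan bilinear_relators"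
  then have "(f - g) - (f' - g') \<in> cspan bilinear_relators"
    by (rule complex_vector.span_diff)
  then show "f - f' - (g - g') \<in> cspan bilinear_relators"
    by (simp add: algebra_simps)
qed

lift_definition scaleC_tensor :: "complex \<Rightarrow> ('a, 'b) tensor \<Rightarrow> ('a, 'b) tensor" is "(*\<^sub>C)"
  unfolding tensor_rel_def
  by (metis complex_vector.scale_right_diff_distrib complex_vector.span_scale)

instance
proof
  note refl = equivp_reflp[OF equivp_tensor_rel]
  fix a b c :: "('a, 'b) tensor" and r s :: complex
  show "a + b + c = a + (b + c)" by transfer (simp add: add.assoc refl)
  show "a + b = b + a" by transfer (simp add: add.commute refl)
  show "0 + a = a" by transfer (simp add: refl)
  show "- a + a = 0" by transfer (simp add: refl)
  show "a - b = a + - b" by transfer (simp add: refl)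
  show "r *\<^sub>C (a + b) = r *\<^sub>C a + r *\<^sub>C b" by transfer (simp add: scaleC_add_right refl)
  show "(r + s) *\<^sub>C a = r *\<^sub>C a + s *\<^sub>C a" by transfer (simp add: scaleC_add_left refl)
  show "r *\<^sub>C (s *\<^sub>C a) = (r * s) *\<^sub>C a" by transfer (simp add: scaleC_scaleC refl)
  show "1 *\<^sub>C a = a" by transfer (simp add: scaleC_one refl)
qed

end

lift_definition tens :: "'a::complex_vector \<Rightarrow> 'b::complex_vector \<Rightarrow> ('a, 'b) tensor"  (infixr "\<otimes>" 76)
  is pair_gen .

lemma cbilinear_tens: "cbilinear (\<otimes>)"
proof -
  have rel: "tensor_rel f g" if "f - g \<in> bilinear_relators" for f g :: "'a \<times> 'b \<Rightarrow>\<^sub>0 complex"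
    unfolding tensor_rel_def using that by (rule complex_vector.span_base)
  have 1: "(x + x') \<otimes> y = x \<otimes> y + x' \<otimes> y" for x x' :: 'a and y :: 'b
    by transfer (rule rel, force simp: bilinear_relators_def diff_diff_eq)
  have 2: "x \<otimes> (y + y') = x \<otimes> y + x \<otimes> y'" for x :: 'a and y y' :: 'b
    by transfer (rule rel, force simp: bilinear_relators_def diff_diff_eq)
  have 3: "(c *\<^sub>C x) \<otimes> y = c *\<^sub>C (x \<otimes> y)" for c and x :: 'a and y :: 'b
    by transfer (rule rel, force simp: bilinear_relators_def)
  have 4: "x \<otimes> (c *\<^sub>C y) = c *\<^sub>C (x \<otimes> y)" for c and x :: 'a and y :: 'b
    by transfer (rule rel, force simp: bilinear_relators_def)
  show ?thesis
    unfolding cbilinear_def Vector_Spaces.linear_def module_hom_def module_hom_axioms_def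
    by (simp add: 1 2 3 4 complex_vector.vector_space_axioms complex_vector.module_axioms)
qed

text \<open>The linear map on the tensor product induced by a bilinear map.  The definition evaluates
  \<open>B\<close> on a chosen representative, which is immaterial for bilinear \<open>B\<close>.\<close>

definition free_lift ::
    "('a \<Rightarrow> 'b \<Rightarrow> 'c::complex_vector) \<Rightarrow> ('a \<times> 'b \<Rightarrow>\<^sub>0 complex) \<Rightarrow> 'c"
  where "free_lift B f =
    (\<Sum>p\<in>Poly_Mapping.keys f. Poly_Mapping.lookup f p *\<^sub>C B (fst p) (snd p))"

definition tensor_lift ::
    "('a::complex_vector \<Rightarrow> 'b::complex_vector \<Rightarrow> 'c::complex_vector) \<Rightarrow> ('a, 'b) tensor \<Rightarrow> 'c"
  where "tensor_lift B t = free_lift B (rep_tensor t)"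

lemma clinearI:
  assumes "\<And>x y. f (x + y) = f x + f y" "\<And>c x. f (c *\<^sub>C x) = c *\<^sub>C f x"
  shows "clinear f"
  unfolding Vector_Spaces.linear_def module_hom_def module_hom_axioms_def
  using assms by (simp add: complex_vector.vector_space_axioms complex_vector.module_axioms)

lemma clinear_add: "clinear f \<Longrightarrow> f (x + y) = f x + f y"
  unfolding Vector_Spaces.linear_def by (blast dest: module_hom.add)

lemma clinear_scaleC: "clinear f \<Longrightarrow> f (c *\<^sub>C x) = c *\<^sub>C f x"
  unfolding Vector_Spaces.linear_def by (blast dest: module_hom.scale)

lemma clinear_diff: "clinear f \<Longrightarrow> f (x - y) = f x - f y"
  unfolding Vector_Spaces.linear_def by (blast dest: module_hom.diff)

lemma clinear_free_lift: "clinear (free_lift B)"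
proof (rule clinearI)
  fix f g :: "'a \<times> 'b \<Rightarrow>\<^sub>0 complex" and c :: complex
  show "free_lift B (f + g) = free_lift B f + free_lift B g"
    unfolding free_lift_def
    by (rule setsum_keys_plus_distrib) (simp_all add: scaleC_add_left)
  show "free_lift B (c *\<^sub>C f) = c *\<^sub>C free_lift B f"
  proof -
    have "free_lift B (c *\<^sub>C f) = (\<Sum>p\<in>Poly_Mapping.keys f.
        Poly_Mapping.lookup (c *\<^sub>C f) p *\<^sub>C B (fst p) (snd p))"
      unfolding free_lift_def
      by (rule sum.mono_neutral_left) (auto simp: in_keys_iff lookup_scaleC)
    then show ?thesis
      by (simp add: free_lift_def lookup_scaleC complex_vector.scale_sum_right scaleC_scaleC
          scaleC_complex_def)
  qed
qed

lemma free_lift_pair_gen: "free_lift B (pair_gen x y) = B x y"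
  by (simp add: free_lift_def scaleC_one)

lemma free_lift_cong:
  assumes "cbilinear B" and "tensor_rel f g"
  shows "free_lift B f = free_lift B g"
proof -
  note fl = clinear_free_lift[of B]
  note lin = clinear_add[OF fl] clinear_scaleC[OF fl] clinear_diff[OF fl] free_lift_pair_gen
  have B: "clinear (B x)" "clinear (\<lambda>x. B x y)" for x y
    using assms(1) by (auto simp: cbilinear_def)
  note bil = clinear_add[OF B(1)] clinear_scaleC[OF B(1)] clinear_add[OF B(2)] clinear_scaleC[OF B(2)]
  have "free_lift B h = 0" if "h \<in> cspan bilinear_relators" for h
    using that
  proof (induction h rule: complex_vector.span_induct_alt)
    case base
    then show ?case by (simp add: free_lift_def)
  next
    case (step c x y)
    from step(1) have "free_lift B x = 0"
      unfolding bilinear_relators_def by (auto simp: lin bil)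
    with step show ?case by (simp add: lin)
  qed
  from this[of "f - g"] assms(2) show ?thesis
    by (simp add: tensor_rel_def lin)
qed

lemma tensor_rel_rep_abs: "tensor_rel (rep_tensor (abs_tensor f)) f"
  using Quotient_rel_rep[OF Quotient_tensor] rep_abs_rsp_left[OF Quotient3_tensor]
    equivp_reflp[OF equivp_tensor_rel] by blast

lemma tensor_lift_abs: "cbilinear B \<Longrightarrow> tensor_lift B (abs_tensor f) = free_lift B f"
  unfolding tensor_lift_def by (rule free_lift_cong[OF _ tensor_rel_rep_abs])

lemma tensor_lift_tens [simp]: "cbilinear B \<Longrightarrow> tensor_lift B (x \<otimes> y) = B x y"
  by (simp add: tens.abs_eq tensor_lift_abs free_lift_pair_gen)

lemma clinear_tensor_lift:
  assumes "cbilinear B"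
  shows "clinear (tensor_lift B)"
proof (rule clinearI)
  fix s t :: "('a, 'b) tensor" and c :: complex
  obtain f g where [simp]: "s = abs_tensor f" "t = abs_tensor g"
    by (metis Quotient_abs_rep[OF Quotient_tensor])
  show "tensor_lift B (s + t) = tensor_lift B s + tensor_lift B t"
    by (simp add: plus_tensor.abs_eq tensor_lift_abs[OF assms] clinear_add[OF clinear_free_lift])
  show "tensor_lift B (c *\<^sub>C s) = c *\<^sub>C tensor_lift B s"
    by (simp add: scaleC_tensor.abs_eq tensor_lift_abs[OF assms] clinear_scaleC[OF clinear_free_lift])
qed


section \<open>Operators on a Hilbert space\<close>

definition bounded_clinear :: "('h::complex_inner \<Rightarrow> 'h) \<Rightarrow> bool"
  where "bounded_clinear a \<longleftrightarrow> clinear a \<and> bounded_linear a"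

definition orth_projection :: "('h::complex_inner \<Rightarrow> 'h) \<Rightarrow> bool"
  where "orth_projection P \<longleftrightarrow>
    bounded_clinear P \<and> P \<circ> P = P \<and> (\<forall>x y. cinner (P x) y = cinner x (P y))"

definition orthogonal_projections :: "('h::complex_inner \<Rightarrow> 'h) \<Rightarrow> ('h \<Rightarrow> 'h) \<Rightarrow> bool"
  where "orthogonal_projections P Q \<longleftrightarrow> P \<circ> Q = (\<lambda>_. 0)"

definition unitary_iso :: "('k::complex_inner \<Rightarrow> 'h::complex_inner) \<Rightarrow> bool"
  where "unitary_iso f \<longleftrightarrow> clinear f \<and> bij f \<and> (\<forall>x y. cinner (f x) (f y) = cinner x y)"

text \<open>The Hilbert tensor product of \<open>'h\<close> with itself is the completion of the algebraic tensor
  product with respect to the inner product determined on elementary tensors below.  A completion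
  is given here as a Hilbert space \<open>'k\<close> together with the canonical map \<open>J\<close> into it,
  isometric and with dense range.\<close>

definition hilbert_tensor_product ::
    "(('h::complex_hilbert, 'h) tensor \<Rightarrow> 'k::complex_hilbert) \<Rightarrow> bool"
  where "hilbert_tensor_product J \<longleftrightarrow>
    clinear J \<and>
    (\<forall>\<xi> \<eta> \<xi>' \<eta>'. cinner (J (\<xi> \<otimes> \<eta>)) (J (\<xi>' \<otimes> \<eta>')) = cinner \<xi> \<xi>' * cinner \<eta> \<eta>') \<and>
    closure (range J) = UNIV"

definition diamond ::
    "(('h::complex_hilbert, 'h) tensor \<Rightarrow> 'k::complex_hilbert) \<Rightarrow> ('k \<Rightarrow> 'h) \<Rightarrow> 'h \<Rightarrow> 'h \<Rightarrow> 'h"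
  where "diamond J \<iota> \<xi> \<eta> = \<iota> (J (\<xi> \<otimes> \<eta>))"

lemma cbilinear_diamond:
  assumes "clinear J" "clinear \<iota>"
  shows "cbilinear (diamond J \<iota>)"
proof -
  have B: "clinear (\<lambda>y. x \<otimes> y)" "clinear (\<lambda>x. x \<otimes> y)" for x y :: 'a
    using cbilinear_tens by (auto simp: cbilinear_def)
  show ?thesis
    unfolding cbilinear_def diamond_def
    by (auto intro!: clinearI
        simp: clinear_add[OF B(1)] clinear_add[OF B(2)] clinear_scaleC[OF B(1)] clinear_scaleC[OF B(2)]
          clinear_add[OF assms(1)] clinear_add[OF assms(2)] clinear_scaleC[OF assms(1)]
          clinear_scaleC[OF assms(2)])
qed


section \<open>PL-spaces and L-spaces\<close>

text \<open>The space \<open>HE\<close> is \<open>('h, 'e) tensor\<close>.\<close>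

definition act :: "('h::complex_vector \<Rightarrow> 'h) \<Rightarrow> ('h, 'e::complex_vector) tensor \<Rightarrow> ('h, 'e) tensor"
    (infixr "\<bullet>\<^sub>m" 75)
  where "a \<bullet>\<^sub>m u = tensor_lift (\<lambda>\<xi> x. a \<xi> \<otimes> x) u"

definition is_norm :: "('v::complex_vector \<Rightarrow> real) \<Rightarrow> bool"
  where "is_norm n \<longleftrightarrow>
    (\<forall>x. 0 \<le> n x) \<and>
    (\<forall>x. n x = 0 \<longleftrightarrow> x = 0) \<and>
    (\<forall>x y. n (x + y) \<le> n x + n y) \<and>
    (\<forall>c x. n (c *\<^sub>C x) = cmod c * n x)"

definition PL_space :: "(('h::complex_hilbert, 'e::complex_vector) tensor \<Rightarrow> real) \<Rightarrow> bool"
  where "PL_space n \<longleftrightarrow>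
    is_norm n \<and> (\<forall>a u. bounded_clinear a \<longrightarrow> n (a \<bullet>\<^sub>m u) \<le> onorm a * n u)"

definition is_support ::
    "('h::complex_hilbert \<Rightarrow> 'h) \<Rightarrow> ('h, 'e::complex_vector) tensor \<Rightarrow> bool"
  where "is_support P u \<longleftrightarrow> orth_projection P \<and> P \<bullet>\<^sub>m u = u"

definition L_space :: "(('h::complex_hilbert, 'e::complex_vector) tensor \<Rightarrow> real) \<Rightarrow> bool"
  where "L_space n \<longleftrightarrow>
    PL_space n \<and>
    (\<forall>u v. (\<exists>P Q. is_support P u \<and> is_support Q v \<and> orthogonal_projections P Q) \<longrightarrow>
      (n (u + v))\<^sup>2 \<le> (n u)\<^sup>2 + (n v)\<^sup>2)"


section \<open>Amplifications and L-bounded operators\<close>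

text \<open>The type \<open>'h\<close> does not occur in the type of the operator; it is determined by the PL-norms,
  or by the argument of the amplification.\<close>

definition amplify ::
    "('e::complex_vector \<Rightarrow> 'f::complex_vector) \<Rightarrow> ('h::complex_hilbert, 'e) tensor \<Rightarrow> ('h, 'f) tensor"
  where "amplify \<phi> = tensor_lift (\<lambda>\<xi> x. \<xi> \<otimes> \<phi> x)"

definition L_bounded ::
    "(('h::complex_hilbert, 'e::complex_vector) tensor \<Rightarrow> real) \<Rightarrow>
     (('h, 'f::complex_vector) tensor \<Rightarrow> real) \<Rightarrow> ('e \<Rightarrow> 'f) \<Rightarrow> bool"
  where "L_bounded nE nF \<phi> \<longleftrightarrow> (\<exists>K. \<forall>u. nF (amplify \<phi> u) \<le> K * nE u)"

definition lb_norm ::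
    "(('h::complex_hilbert, 'e::complex_vector) tensor \<Rightarrow> real) \<Rightarrow>
     (('h, 'f::complex_vector) tensor \<Rightarrow> real) \<Rightarrow> ('e \<Rightarrow> 'f) \<Rightarrow> real"
  where "lb_norm nE nF \<phi> = Sup {nF (amplify \<phi> u) | u. nE u \<le> 1}"

text \<open>In the bilinear case \<open>D\<close> is the product \<open>\<xi> \<diamondsuit> \<eta>\<close> on \<open>'h\<close>.\<close>

definition amplify2 ::
    "('h::complex_hilbert \<Rightarrow> 'h \<Rightarrow> 'h) \<Rightarrow>
     ('e::complex_vector \<Rightarrow> 'f::complex_vector \<Rightarrow> 'g::complex_vector) \<Rightarrow>
     ('h, 'e) tensor \<Rightarrow> ('h, 'f) tensor \<Rightarrow> ('h, 'g) tensor"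
  where "amplify2 D B u v =
    tensor_lift (\<lambda>\<xi> x. tensor_lift (\<lambda>\<eta> y. D \<xi> \<eta> \<otimes> B x y) v) u"

definition L_bounded2 ::
    "('h::complex_hilbert \<Rightarrow> 'h \<Rightarrow> 'h) \<Rightarrow>
     (('h, 'e::complex_vector) tensor \<Rightarrow> real) \<Rightarrow> (('h, 'f::complex_vector) tensor \<Rightarrow> real) \<Rightarrow>
     (('h, 'g::complex_vector) tensor \<Rightarrow> real) \<Rightarrow> ('e \<Rightarrow> 'f \<Rightarrow> 'g) \<Rightarrow> bool"
  where "L_bounded2 D nE nF nG B \<longleftrightarrow>
    (\<exists>K. \<forall>u v. nG (amplify2 D B u v) \<le> K * nE u * nF v)"

definition L_contractive2 ::
    "('h::complex_hilbert \<Rightarrow> 'h \<Rightarrow> 'h) \<Rightarrow>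
     (('h, 'e::complex_vector) tensor \<Rightarrow> real) \<Rightarrow> (('h, 'f::complex_vector) tensor \<Rightarrow> real) \<Rightarrow>
     (('h, 'g::complex_vector) tensor \<Rightarrow> real) \<Rightarrow> ('e \<Rightarrow> 'f \<Rightarrow> 'g) \<Rightarrow> bool"
  where "L_contractive2 D nE nF nG B \<longleftrightarrow>
    (\<forall>u v. nG (amplify2 D B u v) \<le> nE u * nF v)"

definition lb_norm2 ::
    "('h::complex_hilbert \<Rightarrow> 'h \<Rightarrow> 'h) \<Rightarrow>
     (('h, 'e::complex_vector) tensor \<Rightarrow> real) \<Rightarrow> (('h, 'f::complex_vector) tensor \<Rightarrow> real) \<Rightarrow>
     (('h, 'g::complex_vector) tensor \<Rightarrow> real) \<Rightarrow> ('e \<Rightarrow> 'f \<Rightarrow> 'g) \<Rightarrow> real"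
  where "lb_norm2 D nE nF nG B =
    Sup {nG (amplify2 D B u v) | u v. nE u \<le> 1 \<and> nF v \<le> 1}"


section \<open>The norm of the tensor product of PL-spaces\<close>

definition diamond_tensor ::
    "('h::complex_hilbert \<Rightarrow> 'h \<Rightarrow> 'h) \<Rightarrow> ('h, 'e::complex_vector) tensor \<Rightarrow>
     ('h, 'f::complex_vector) tensor \<Rightarrow> ('h, ('e, 'f) tensor) tensor"
  where "diamond_tensor D u v =
    tensor_lift (\<lambda>\<xi> x. tensor_lift (\<lambda>\<eta> y. D \<xi> \<eta> \<otimes> (x \<otimes> y)) v) u"

definition pairwise_orthogonal_supports ::
    "nat \<Rightarrow> (nat \<Rightarrow> ('h::complex_hilbert, 'e::complex_vector) tensor) \<Rightarrow> bool"
  where "pairwise_orthogonal_supports n u \<longleftrightarrow>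
    (\<exists>P. (\<forall>k\<in>{1..n}. is_support (P k) (u k)) \<and>
      (\<forall>k\<in>{1..n}. \<forall>l\<in>{1..n}. k \<noteq> l \<longrightarrow> orthogonal_projections (P k) (P l)))"

definition l_norm ::
    "('h::complex_hilbert \<Rightarrow> 'h \<Rightarrow> 'h) \<Rightarrow>
     (('h, 'e::complex_vector) tensor \<Rightarrow> real) \<Rightarrow> (('h, 'f::complex_vector) tensor \<Rightarrow> real) \<Rightarrow>
     ('h, ('e, 'f) tensor) tensor \<Rightarrow> real"
  where "l_norm D nE nF U =
    Inf {onorm a * sqrt (\<Sum>k = 1..n. (nE (u k))\<^sup>2 * (nF (v k))\<^sup>2) | n a u v.
      bounded_clinear a \<and> pairwise_orthogonal_supports n u \<and>
      U = a \<bullet>\<^sub>m (\<Sum>k = 1..n. diamond_tensor D (u k) (v k))}"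


section \<open>The amplifications on elementary tensors\<close>

lemma cbilinear_tens_comp:
  assumes "clinear f" "clinear g"
  shows "cbilinear (\<lambda>x y. f x \<otimes> g y)"
proof -
  have B: "clinear (\<lambda>y. x \<otimes> y)" "clinear (\<lambda>x. x \<otimes> y)" for x :: 'b and y :: 'd
    using cbilinear_tens by (auto simp: cbilinear_def)
  show ?thesis
    unfolding cbilinear_def
    by (auto intro!: clinearI
        simp: clinear_add[OF B(1)] clinear_add[OF B(2)] clinear_scaleC[OF B(1)] clinear_scaleC[OF B(2)]
          clinear_add[OF assms(1)] clinear_add[OF assms(2)] clinear_scaleC[OF assms(1)]
          clinear_scaleC[OF assms(2)])
qed

lemma act_tens: "clinear a \<Longrightarrow> a \<bullet>\<^sub>m (\<xi> \<otimes> x) = a \<xi> \<otimes> x"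
  unfolding act_def
  by (intro tensor_lift_tens cbilinear_tens_comp[of a "\<lambda>x. x"]) (auto intro: clinearI)

lemma amplify_tens: "clinear \<phi> \<Longrightarrow> amplify \<phi> (\<xi> \<otimes> x) = \<xi> \<otimes> \<phi> x"
  unfolding amplify_def
  by (intro tensor_lift_tens cbilinear_tens_comp[of "\<lambda>x. x" \<phi>]) (auto intro: clinearI)

lemma tens_induct [case_names zero add]:
  fixes t :: "('a::complex_vector, 'b::complex_vector) tensor"
  assumes zero: "P 0" and add: "\<And>x y t. P t \<Longrightarrow> P (x \<otimes> y + t)"
  shows "P t"
proof -
  have "P (abs_tensor f)" for f :: "'a \<times> 'b \<Rightarrow>\<^sub>0 complex"
  proof (induction f rule: update_induct)
    case const
    then show ?case using zero by (simp add: zero_tensor_def)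
  next
    case (update f p c)
    obtain x y where p: "p = (x, y)" by force
    have "Poly_Mapping.update p c f = c *\<^sub>C pair_gen x y + f"
      using update(1)
      by (intro poly_mapping_eqI)
        (auto simp: p lookup_scaleC lookup_single when_def scaleC_complex_def lookup_add
          lookup_update in_keys_iff)
    then have "abs_tensor (Poly_Mapping.update p c f) = c *\<^sub>C (x \<otimes> y) + abs_tensor f"
      by (simp add: scaleC_tensor.abs_eq tens.abs_eq plus_tensor.abs_eq)
    also have "c *\<^sub>C (x \<otimes> y) = (c *\<^sub>C x) \<otimes> y"
      using cbilinear_tens[where 'a='a and 'b='b]
      by (simp add: cbilinear_def clinear_scaleC[of "\<lambda>x. x \<otimes> y"])
    finally show ?case using add[OF update(3)] by simp
  qed
  then show ?thesis by (metis Quotient_abs_rep[OF Quotient_tensor])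
qed

lemma clinear_plus:
  assumes "clinear f" "clinear g"
  shows "clinear (\<lambda>x. f x + g x)"
  using assms
  by (intro clinearI) (simp_all add: clinear_add clinear_scaleC scaleC_add_right algebra_simps)

lemma clinear_zero: "clinear f \<Longrightarrow> f 0 = 0"
  using clinear_scaleC[of f 0 0] by simp

lemma cbilinear_amplify2_aux:
  assumes D: "cbilinear D" and B: "cbilinear B"
  shows "cbilinear (\<lambda>\<xi> x. tensor_lift (\<lambda>\<eta> y. D \<xi> \<eta> \<otimes> B x y) v)"
proof -
  have lin: "clinear (D \<xi>)" "clinear (B x)" "clinear (\<lambda>\<xi>. D \<xi> \<eta>)" "clinear (\<lambda>x. B x y)"
    for \<xi> \<eta> x y
    using D B by (auto simp: cbilinear_def)
  have inner: "cbilinear (\<lambda>\<eta> y. D \<xi> \<eta> \<otimes> B x y)" for \<xi> x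
    by (rule cbilinear_tens_comp[OF lin(1,2)])
  have out: "cbilinear (\<lambda>\<xi> x. D \<xi> \<eta> \<otimes> B x y)" for \<eta> y
    by (rule cbilinear_tens_comp[OF lin(3,4)])
  note l = clinear_tensor_lift[OF inner]
  show ?thesis
  proof (induction v rule: tens_induct)
    case zero
    then show ?case
      by (simp add: clinear_zero[OF l] cbilinear_def clinearI)
  next
    case (add \<eta> y v)
    from add out[of \<eta> y] show ?case
      unfolding cbilinear_def clinear_add[OF l] tensor_lift_tens[OF inner]
      by (auto intro: clinear_plus)
  qed
qed

lemma amplify2_tens:
  assumes "cbilinear D" "cbilinear B"
  shows "amplify2 D B (\<xi> \<otimes> x) (\<eta> \<otimes> y) = D \<xi> \<eta> \<otimes> B x y"
proof -
  have "cbilinear (\<lambda>\<eta> y. D \<xi> \<eta> \<otimes> B x y)"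
    using assms by (intro cbilinear_tens_comp) (auto simp: cbilinear_def)
  then show ?thesis
    by (simp add: amplify2_def cbilinear_amplify2_aux[OF assms])
qed

lemma cbilinear_amplify2:
  assumes "cbilinear D" "cbilinear B"
  shows "cbilinear (amplify2 D B)"
proof -
  have lin: "clinear (\<lambda>u. amplify2 D B u v)" for v
    unfolding amplify2_def by (rule clinear_tensor_lift[OF cbilinear_amplify2_aux[OF assms]])
  have inner: "cbilinear (\<lambda>\<eta> y. D \<xi> \<eta> \<otimes> B x y)" for \<xi> x
    using assms by (intro cbilinear_tens_comp) (auto simp: cbilinear_def)
  have elem: "clinear (amplify2 D B (\<xi> \<otimes> x))" for \<xi> x
    using clinear_tensor_lift[OF inner, of \<xi> x]
    by (simp add: amplify2_def[abs_def] cbilinear_amplify2_aux[OF assms])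
  have "clinear (amplify2 D B u)" for u
  proof (induction u rule: tens_induct)
    case zero
    then show ?case by (simp add: clinear_zero[OF lin] clinearI)
  next
    case (add \<xi> x u)
    then show ?case
      using elem[of \<xi> x]
      by (auto intro!: clinearI simp: clinear_add[OF lin] clinear_add clinear_scaleC
          scaleC_add_right algebra_simps)
  qed
  with lin show ?thesis by (simp add: cbilinear_def)
qed

lemma diamond_tensor_tens:
  "cbilinear D \<Longrightarrow> diamond_tensor D (\<xi> \<otimes> x) (\<eta> \<otimes> y) = D \<xi> \<eta> \<otimes> (x \<otimes> y)"
  using amplify2_tens[OF _ cbilinear_tens] by (simp add: amplify2_def diamond_tensor_def)

end

theory Submission
  imports Defs
begin

text \<open>Multiplication by two orthonormal vectors, \<open>\<xi> \<mapsto> e\<^sub>i \<diamondsuit> \<xi>\<close>, embeds \<open>H\<close> isometrically into two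
  orthogonal subspaces, so two representations \<open>a \<cdot> W\<close> and \<open>b \<cdot> W'\<close> can be moved onto orthogonal
  supports and merged into one, \<open>c \<cdot> W''\<close> with \<open>c = a T\<^sub>1 + b T\<^sub>2\<close> and
  \<open>\<parallel>T\<^sub>1 z\<parallel>\<^sup>2 + \<parallel>T\<^sub>2 z\<parallel>\<^sup>2 \<le> \<parallel>z\<parallel>\<^sup>2\<close>; this yields the triangle inequality and the \<open>L\<close>-space inequality.
  For definiteness, Hahn--Banach functionals \<open>f\<close>, \<open>g\<close> on \<open>E\<close>, \<open>F\<close> amplify to contractions into
  \<open>H\<close>, hence so does \<open>f \<otimes> g\<close>, and such functionals separate the points of \<open>E \<otimes> F\<close>.
  For the universal property, the amplified bilinear operator keeps supports orthogonal, so the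
  \<open>L\<close>-space inequality in \<open>G\<close> bounds the linearization.
  Every element involves finitely many vectors of \<open>H\<close>, so finite rank operators suffice throughout.\<close>

section \<open>Linear maps and tensors\<close>

text \<open>The obstacle is the orthogonality demanded of the first factors: listing two
  representations one after the other gives a sum whose supports may overlap, which is not
  admissible under the infimum. Hence the existence of representations, the triangle inequality and
  the \<open>L\<close>-space inequality all pass through the merging step, whose outer operator
  undoes the displacement. The estimate for \<open>T1\<close> and \<open>T2\<close> fixes the
  constants: it is combined with Cauchy-Schwarz for the triangle inequality, and with Pythagoras
  when the two outer operators have orthogonal ranges. The natural \<open>T1\<close>,
  \<open>T2\<close> are adjoints of \<open>S i \<diamondsuit> 1\<close>, and operators
  \<open>a \<diamondsuit> b\<close> would have to be extended to \<open>H\<close> by continuity.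
  Cutting down to finite orthonormal families gives explicit sums instead, with Bessel's inequality
  as the norm bound. Definiteness needs a lower bound valid for all representations at once. The
  functional f \<otimes> g provides it: orthogonal supports of the first factors make the images of
  the summands in \<open>H\<close> orthogonal, so their squared norms add, as they do under the
  infimum.\<close>

lemma clinear_sum: "clinear f \<Longrightarrow> f (\<Sum>i\<in>I. g i) = (\<Sum>i\<in>I. f (g i))"
  by (induction I rule: infinite_finite_induct) (simp_all add: clinear_zero clinear_add)

lemma clinear_comp: "clinear f \<Longrightarrow> clinear g \<Longrightarrow> clinear (\<lambda>x. f (g x))"
  by (rule clinearI) (simp_all add: clinear_add clinear_scaleC)

lemma clinear_ident: "clinear (\<lambda>x. x)"
  by (rule clinearI) simp_all

lemma clinear_scale: "clinear f \<Longrightarrow> clinear (\<lambda>x. c *\<^sub>C f x)"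
  by (rule clinearI) (simp_all add: clinear_add clinear_scaleC scaleC_add_right scaleC_scaleC mult.commute)

lemma clinear_scale_left: "clinear f \<Longrightarrow> clinear (\<lambda>x. f x *\<^sub>C v)"
  by (rule clinearI) (simp_all add: clinear_add clinear_scaleC scaleC_add_left scaleC_scaleC scaleC_complex_def)

lemma clinear_sum_fun: "(\<And>i. i \<in> I \<Longrightarrow> clinear (f i)) \<Longrightarrow> clinear (\<lambda>x. \<Sum>i\<in>I. f i x)"
  by (induction I rule: infinite_finite_induct) (auto intro: clinearI clinear_plus)

lemma cbilinearD:
  assumes "cbilinear B"
  shows "clinear (B x)" "clinear (\<lambda>x. B x y)"
  using assms by (auto simp: cbilinear_def)

lemmas clinear_tens = cbilinearD[OF cbilinear_tens]
lemmas tens_linear = clinear_add[OF clinear_tens(1)] clinear_add[OF clinear_tens(2)]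
  clinear_scaleC[OF clinear_tens(1)] clinear_scaleC[OF clinear_tens(2)]
  clinear_zero[OF clinear_tens(1)] clinear_zero[OF clinear_tens(2)]

lemma clinear_tens_ext:
  assumes "clinear f" "clinear g" "\<And>x y. f (x \<otimes> y) = g (x \<otimes> y)"
  shows "f t = g t"
  by (induction t rule: tens_induct) (simp_all add: clinear_zero clinear_add assms)

lemma cbilinear_tens_ext:
  assumes "cbilinear f" "cbilinear g"
    and "\<And>x y x' y'. f (x \<otimes> y) (x' \<otimes> y') = g (x \<otimes> y) (x' \<otimes> y')"
  shows "f s t = g s t"
proof -
  have "f (x \<otimes> y) t = g (x \<otimes> y) t" for x y
    by (rule clinear_tens_ext[OF cbilinearD(1)[OF assms(1)] cbilinearD(1)[OF assms(2)]]) (rule assms(3))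
  then show ?thesis
    by (rule clinear_tens_ext[OF cbilinearD(2)[OF assms(1)] cbilinearD(2)[OF assms(2)]])
qed

lemma cbilinear_compose:
  assumes "cbilinear B" "clinear f" "clinear g" "clinear h"
  shows "cbilinear (\<lambda>x y. h (B (f x) (g y)))"
  unfolding cbilinear_def
  by (auto intro!: clinearI simp: clinear_add[OF assms(2)] clinear_add[OF assms(3)]
      clinear_add[OF assms(4)] clinear_scaleC[OF assms(2)] clinear_scaleC[OF assms(3)]
      clinear_scaleC[OF assms(4)] clinear_add[OF cbilinearD(1)[OF assms(1)]]
      clinear_add[OF cbilinearD(2)[OF assms(1)]] clinear_scaleC[OF cbilinearD(1)[OF assms(1)]]
      clinear_scaleC[OF cbilinearD(2)[OF assms(1)]])

lemma clinear_act: "clinear a \<Longrightarrow> clinear (act a)"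
  unfolding act_def[abs_def]
  by (intro clinear_tensor_lift cbilinear_tens_comp[of a "\<lambda>x. x"] clinear_ident)

lemmas act_add = clinear_add[OF clinear_act]
lemmas act_scaleC = clinear_scaleC[OF clinear_act]

lemma act_act: "clinear a \<Longrightarrow> clinear b \<Longrightarrow> a \<bullet>\<^sub>m b \<bullet>\<^sub>m u = (\<lambda>z. a (b z)) \<bullet>\<^sub>m u"
  by (rule clinear_tens_ext) (simp_all add: act_tens clinear_comp clinear_act)

lemma act_ident: "(\<lambda>z. z) \<bullet>\<^sub>m u = u"
  by (rule clinear_tens_ext) (simp_all add: act_tens clinear_ident clinear_act)

lemma act_plus: "clinear a \<Longrightarrow> clinear b \<Longrightarrow> (\<lambda>z. a z + b z) \<bullet>\<^sub>m u = a \<bullet>\<^sub>m u + b \<bullet>\<^sub>m u"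
  by (rule clinear_tens_ext) (simp_all add: act_tens clinear_plus clinear_act tens_linear)

lemma act_scale: "clinear a \<Longrightarrow> (\<lambda>z. c *\<^sub>C a z) \<bullet>\<^sub>m u = c *\<^sub>C (a \<bullet>\<^sub>m u)"
  by (rule clinear_tens_ext) (simp_all add: act_tens clinear_scale clinear_act tens_linear)

lemma clinear_amplify: "clinear \<phi> \<Longrightarrow> clinear (amplify \<phi>)"
  unfolding amplify_def by (intro clinear_tensor_lift cbilinear_tens_comp clinear_ident)

lemma amplify_act: "clinear \<phi> \<Longrightarrow> clinear a \<Longrightarrow> amplify \<phi> (a \<bullet>\<^sub>m u) = a \<bullet>\<^sub>m amplify \<phi> u"
  by (rule clinear_tens_ext) (simp_all add: act_tens amplify_tens clinear_comp clinear_act clinear_amplify)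

text \<open>Only the values of \<open>a\<close> at the first legs of some expansion of
  \<open>u\<close> into elementary tensors matter. This is what allows arbitrary projections and
  identities to be replaced by finite rank operators.\<close>

lemma act_finitely_determined:
  "\<exists>A. finite A \<and> (\<forall>a b. clinear a \<longrightarrow> clinear b \<longrightarrow> (\<forall>x\<in>A. a x = b x) \<longrightarrow> a \<bullet>\<^sub>m u = b \<bullet>\<^sub>m u)"
proof (induction u rule: tens_induct)
  case zero
  show ?case by (intro exI[of _ "{}"]) (simp add: clinear_zero[OF clinear_act])
next
  case (add x y t)
  then obtain A where "finite A"
    "\<And>a b. clinear a \<Longrightarrow> clinear b \<Longrightarrow> (\<forall>x\<in>A. a x = b x) \<Longrightarrow> a \<bullet>\<^sub>m t = b \<bullet>\<^sub>m t" by metis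
  then have "finite (insert x A) \<and> (\<forall>a b. clinear a \<longrightarrow> clinear b \<longrightarrow>
      (\<forall>x\<in>insert x A. a x = b x) \<longrightarrow> a \<bullet>\<^sub>m (x \<otimes> y + t) = b \<bullet>\<^sub>m (x \<otimes> y + t))"
    by (metis act_add act_tens finite.insertI insertCI)
  then show ?case ..
qed


section \<open>Orthonormal families\<close>

lemma cinner_add_right: "cinner x (y + z) = cinner x y + cinner x (z::'a::complex_inner)"
  by (metis cinner_add_left cinner_commute complex_cnj_add)

lemma cinner_scaleC_right: "cinner x (c *\<^sub>C y) = cnj c * cinner x (y::'a::complex_inner)"
  by (metis cinner_scaleC_left cinner_commute complex_cnj_mult)

lemma clinear_cinner: "clinear (\<lambda>z. cinner z (w::'a::complex_inner))"
  by (rule clinearI) (simp_all add: cinner_add_left cinner_scaleC_left scaleC_complex_def)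

lemmas cinner_sum_left = clinear_sum[OF clinear_cinner]
lemmas cinner_zero_left = clinear_zero[OF clinear_cinner]
lemmas cinner_diff_left = clinear_diff[OF clinear_cinner]

lemma cinner_zero_right: "cinner x (0::'a::complex_inner) = 0"
  by (metis cinner_commute cinner_zero_left complex_cnj_zero)

lemma cinner_sum_right: "cinner x (\<Sum>i\<in>I. f i) = (\<Sum>i\<in>I. cinner x (f i :: 'a::complex_inner))"
  by (induction I rule: infinite_finite_induct) (simp_all add: cinner_zero_right cinner_add_right)

lemma cinner_self: "cinner x (x::'a::complex_inner) = complex_of_real ((norm x)\<^sup>2)"
proof -
  have "cinner x x \<in> \<real>"
    by (metis Reals_cnj_iff cinner_commute)
  then show ?thesis
    by (metis Re_complex_of_real Reals_cases inner_eq_Re_cinner power2_norm_eq_inner)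
qed

lemma cinner_eq_0_self: "cinner x (x::'a::complex_inner) = 0 \<Longrightarrow> x = 0"
  by (simp add: cinner_self)

lemma norm_eq_1_cinner: "cinner x (x::'a::complex_inner) = 1 \<Longrightarrow> norm x = 1"
  using norm_ge_zero[of x] power2_eq_1_iff[of "norm x"] by (simp add: cinner_self flip: of_real_power)

lemma norm_scaleC: "norm (c *\<^sub>C x) = cmod c * norm (x::'a::complex_inner)"
proof -
  have "complex_of_real ((norm (c *\<^sub>C x))\<^sup>2) = complex_of_real ((cmod c * norm x)\<^sup>2)"
    unfolding cinner_self[symmetric] cinner_scaleC_left cinner_scaleC_right
    using complex_norm_square[of c]
    by (simp add: cinner_self power_mult_distrib mult.commute)
  then have "(norm (c *\<^sub>C x))\<^sup>2 = (cmod c * norm x)\<^sup>2"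
    by (simp only: of_real_eq_iff)
  then show ?thesis by simp
qed

text \<open>A phase turns a modulus into a real part; this carries real estimates over to complex
  ones, in the Cauchy-Schwarz inequality and in the Hahn-Banach theorem.\<close>

lemma exists_phase: "\<exists>c. cmod c = 1 \<and> c * z = complex_of_real (cmod z)"
proof (cases "z = 0")
  case False
  then show ?thesis
    by (intro exI[of _ "cnj z / cmod z"])
      (simp add: norm_divide field_simps complex_norm_square power2_eq_square[symmetric]
        flip: of_real_power)
qed (auto intro: exI[of _ 1])

lemma cmod_cinner_le: "cmod (cinner x y) \<le> norm x * norm (y::'a::complex_inner)"
proof -
  obtain c where c: "cmod c = 1" "c * cinner x y = complex_of_real (cmod (cinner x y))"
    using exists_phase by blast
  have "cmod (cinner x y) = (c *\<^sub>C x) \<bullet> y"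
    by (simp add: inner_eq_Re_cinner cinner_scaleC_left c)
  also have "\<dots> \<le> norm (c *\<^sub>C x) * norm y" by (rule norm_cauchy_schwarz)
  finally show ?thesis by (simp add: norm_scaleC c)
qed

lemma norm_add_orthogonal:
  "cinner x y = 0 \<Longrightarrow> (norm (x + y))\<^sup>2 = (norm x)\<^sup>2 + (norm (y::'a::complex_inner))\<^sup>2"
  using cinner_commute[of y x]
  by (simp add: power2_norm_eq_inner inner_eq_Re_cinner cinner_add_left cinner_add_right)

lemma norm_sum_orthogonal:
  assumes "finite I" "\<And>i j. i \<in> I \<Longrightarrow> j \<in> I \<Longrightarrow> i \<noteq> j \<Longrightarrow> cinner (f i) (f j) = 0"
  shows "(norm (\<Sum>i\<in>I. f i))\<^sup>2 = (\<Sum>i\<in>I. (norm (f i :: 'a::complex_inner))\<^sup>2)"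
  using assms
proof (induction I)
  case (insert i I)
  then have "cinner (f i) (\<Sum>i\<in>I. f i) = 0"
    by (auto simp: cinner_sum_right intro!: sum.neutral)
  with insert show ?case by (simp add: norm_add_orthogonal)
qed simp

section \<open>Bounded complex-linear operators\<close>

lemma bounded_clinearI:
  fixes f :: "'a::complex_inner \<Rightarrow> 'a"
  assumes "clinear f" "\<And>x. norm (f x) \<le> K * norm x"
  shows "bounded_clinear f"
  unfolding bounded_clinear_def
proof
  show "bounded_linear f"
    by (rule bounded_linear_intro[where K=K])
      (simp_all add: assms scaleR_scaleC clinear_add clinear_scaleC mult.commute)
qed (fact assms)

lemma bounded_clinear_clinear: "bounded_clinear f \<Longrightarrow> clinear f"
  by (simp add: bounded_clinear_def)

lemma norm_le_onorm: "bounded_clinear f \<Longrightarrow> norm (f x) \<le> onorm f * norm x"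
  by (simp add: bounded_clinear_def onorm)

lemma onorm_nonneg: "bounded_clinear f \<Longrightarrow> 0 \<le> onorm f"
  by (simp add: bounded_clinear_def onorm_pos_le)

lemma bounded_clinear_comp:
  "bounded_clinear f \<Longrightarrow> bounded_clinear g \<Longrightarrow> bounded_clinear (\<lambda>x. f (g x))"
  by (simp add: bounded_clinear_def clinear_comp bounded_linear_compose)

lemma bounded_clinear_plus:
  "bounded_clinear f \<Longrightarrow> bounded_clinear g \<Longrightarrow> bounded_clinear (\<lambda>x. f x + g x)"
  by (simp add: bounded_clinear_def clinear_plus bounded_linear_add)

lemma bounded_clinear_scale: "bounded_clinear f \<Longrightarrow> bounded_clinear (\<lambda>x. c *\<^sub>C f x)"
  by (rule bounded_clinearI[where K="cmod c * onorm f"])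
    (simp_all add: norm_scaleC clinear_scale bounded_clinear_clinear mult.assoc mult_left_mono
      norm_le_onorm)

lemma bounded_clinear_ident: "bounded_clinear (\<lambda>x. x)"
  by (simp add: bounded_clinear_def clinear_ident)

text \<open>Finiteness is built in, so all sums below are genuine. Families are used because index
  sets such as \<open>X \<times> Y\<close> occur, with products as members; a plain set is the
  family \<open>\<lambda>b. b\<close>.\<close>

definition orthonormal_on :: "'i set \<Rightarrow> ('i \<Rightarrow> 'a::complex_inner) \<Rightarrow> bool"
  where "orthonormal_on I e \<longleftrightarrow>
    finite I \<and> (\<forall>i\<in>I. \<forall>j\<in>I. cinner (e i) (e j) = (if i = j then 1 else 0))"

text \<open>For orthonormal families, the partial isometry taking \<open>e i\<close> to \<open>f i\<close>.\<close>

definition transfer_op :: "'i set \<Rightarrow> ('i \<Rightarrow> 'a::complex_inner) \<Rightarrow> ('i \<Rightarrow> 'a) \<Rightarrow> 'a \<Rightarrow> 'a"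
  where "transfer_op I e f z = (\<Sum>i\<in>I. cinner z (e i) *\<^sub>C f i)"

abbreviation proj_op :: "'i set \<Rightarrow> ('i \<Rightarrow> 'a::complex_inner) \<Rightarrow> 'a \<Rightarrow> 'a"
  where "proj_op I e \<equiv> transfer_op I e e"

lemma clinear_transfer_op: "clinear (transfer_op I e f)"
  unfolding transfer_op_def[abs_def]
  by (intro clinear_sum_fun clinear_scale_left clinear_cinner)

text \<open>Only the target family has to be orthonormal. The right-hand side is then bounded by
  Bessel's inequality, in \<open>diamond_sum_combine\<close> for two source families
  jointly.\<close>

lemma norm_transfer_op:
  assumes "orthonormal_on I f"
  shows "(norm (transfer_op I e f z))\<^sup>2 = (\<Sum>i\<in>I. (cmod (cinner z (e i)))\<^sup>2)"
proof -
  have 1: "norm (f i) = 1" if "i \<in> I" for i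
    using assms that by (intro norm_eq_1_cinner) (simp add: orthonormal_on_def)
  show ?thesis
    unfolding transfer_op_def using assms
    by (subst norm_sum_orthogonal)
      (auto simp: orthonormal_on_def cinner_scaleC_left cinner_scaleC_right norm_scaleC 1)
qed

lemma transfer_op_cinner:
  assumes "orthonormal_on I f" "i \<in> I"
  shows "cinner (transfer_op I e f z) (f i) = cinner z (e i)"
proof -
  have "cinner (transfer_op I e f z) (f i) = (\<Sum>j\<in>I. if j = i then cinner z (e j) else 0)"
    unfolding transfer_op_def cinner_sum_left using assms
    by (intro sum.cong) (auto simp: orthonormal_on_def cinner_scaleC_left)
  then show ?thesis using assms by (simp add: orthonormal_on_def)
qed

lemma transfer_op_base:
  assumes "orthonormal_on I e" "i \<in> I"
  shows "transfer_op I e f (e i) = f i"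
proof -
  have "transfer_op I e f (e i) = (\<Sum>j\<in>I. if i = j then f j else 0)"
    unfolding transfer_op_def using assms
    by (intro sum.cong) (auto simp: orthonormal_on_def scaleC_one)
  then show ?thesis using assms by (simp add: orthonormal_on_def)
qed

lemma cinner_proj_op: "cinner (proj_op I e x) y = cinner x (proj_op I e y)"
proof -
  have "cinner (cinner x (e i) *\<^sub>C e i) y = cinner x (cinner y (e i) *\<^sub>C e i)" for i
    unfolding cinner_scaleC_left cinner_scaleC_right
    using cinner_commute[of "e i" y] by (simp only: mult.commute)
  then show ?thesis
    by (simp only: transfer_op_def cinner_sum_left cinner_sum_right)
qed

text \<open>Pythagoras for the projection of \<open>z\<close> and its residual, which is orthogonal
  to every \<open>e i\<close>.\<close>

lemma bessel:
  assumes "orthonormal_on I e"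
  shows "(\<Sum>i\<in>I. (cmod (cinner z (e i)))\<^sup>2) \<le> (norm z)\<^sup>2"
proof -
  let ?p = "proj_op I e z"
  have "cinner ?p (z - ?p) = (\<Sum>i\<in>I. cinner z (e i) * cinner (e i) (z - ?p))"
    by (subst transfer_op_def) (simp add: cinner_sum_left cinner_scaleC_left)
  also have "\<dots> = 0"
  proof (intro sum.neutral ballI)
    fix i assume "i \<in> I"
    then have "cinner (z - ?p) (e i) = 0"
      by (simp add: cinner_diff_left transfer_op_cinner[OF assms])
    then show "cinner z (e i) * cinner (e i) (z - ?p) = 0"
      by (subst (2) cinner_commute) simp
  qed
  finally have "(norm (?p + (z - ?p)))\<^sup>2 = (norm ?p)\<^sup>2 + (norm (z - ?p))\<^sup>2"
    by (rule norm_add_orthogonal)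
  then show ?thesis by (simp add: norm_transfer_op[OF assms])
qed

lemma norm_transfer_op_le:
  assumes "orthonormal_on I e" "orthonormal_on I f"
  shows "norm (transfer_op I e f z) \<le> norm z"
  using bessel[OF assms(1), of z] by (auto simp: norm_transfer_op[OF assms(2), symmetric] dest: power2_le_imp_le)

lemma bounded_clinear_transfer_op:
  assumes "orthonormal_on I e" "orthonormal_on I f"
  shows "bounded_clinear (transfer_op I e f)"
  by (rule bounded_clinearI[where K=1]) (simp_all add: clinear_transfer_op norm_transfer_op_le assms)

lemma orth_projection_proj_op:
  assumes "orthonormal_on I e"
  shows "orth_projection (proj_op I e)"
proof -
  have "proj_op I e (proj_op I e z) = proj_op I e z" for z
    by (subst (1 3) transfer_op_def) (intro sum.cong, auto simp: transfer_op_cinner[OF assms])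
  then show ?thesis
    unfolding orth_projection_def by (simp add: bounded_clinear_transfer_op assms cinner_proj_op fun_eq_iff)
qed

lemma orthogonal_projections_proj_op:
  assumes "\<And>i j. i \<in> I \<Longrightarrow> j \<in> J \<Longrightarrow> cinner (f j) (e i) = 0"
  shows "orthogonal_projections (proj_op I e) (proj_op J f)"
proof -
  have "proj_op I e (proj_op J f z) = 0" for z
    unfolding transfer_op_def
    by (intro sum.neutral ballI) (simp add: cinner_sum_left cinner_scaleC_left assms)
  then show ?thesis by (simp add: orthogonal_projections_def fun_eq_iff)
qed

section \<open>Finite orthonormal bases and finite rank supports\<close>

lemma proj_op_span:
  assumes "orthonormal_on B (\<lambda>b. b)" "x \<in> cspan B"
  shows "proj_op B (\<lambda>b. b) x = x"
  using assms(2)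
proof (induction rule: complex_vector.span_induct_alt)
  case base
  show ?case by (rule clinear_zero[OF clinear_transfer_op])
next
  case (step c x y)
  then show ?case
    using transfer_op_base[OF assms(1), of x "\<lambda>b. b"]
    by (simp add: clinear_add[OF clinear_transfer_op] clinear_scaleC[OF clinear_transfer_op])
qed

text \<open>The inclusion of \<open>B\<close> in the span of \<open>A\<close> is there for
  \<open>support_proj\<close>: it keeps the new basis inside the range of a given
  projection.\<close>

lemma gram_schmidt:
  assumes "finite A"
  shows "\<exists>B. orthonormal_on B (\<lambda>b. b) \<and> A \<subseteq> cspan B \<and> B \<subseteq> cspan (A :: 'a::complex_inner set)"
  using assms
proof (induction A)
  case empty
  show ?case by (intro exI[of _ "{}"]) (simp add: orthonormal_on_def)
next
  case (insert a A)
  then obtain B where B: "orthonormal_on B (\<lambda>b. b)" "A \<subseteq> cspan B" "B \<subseteq> cspan A" by blast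
  have BA: "B \<subseteq> cspan (insert a A)"
    using B(3) complex_vector.span_mono[of A "insert a A"] by blast
  have p: "proj_op B (\<lambda>b. b) a \<in> cspan B"
    unfolding transfer_op_def by (auto intro: complex_vector.span_sum complex_vector.span_scale complex_vector.span_base)
  define w where "w = a - proj_op B (\<lambda>b. b) a"
  show ?case
  proof (cases "w = 0")
    case True
    then have "a \<in> cspan B" using p by (simp add: w_def)
    with B BA show ?thesis by (intro exI[of _ B]) auto
  next
    case False
    define c where "c = complex_of_real (1 / norm w) *\<^sub>C w"
    have w: "w = complex_of_real (norm w) *\<^sub>C c"
      using False by (simp add: c_def scaleC_scaleC scaleC_one)
    have wB: "cinner w b = 0" if "b \<in> B" for b
      using transfer_op_cinner[OF B(1) that, of "\<lambda>b. b" a] by (simp add: w_def cinner_diff_left)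
    then have cB: "cinner c b = 0" "cinner b c = 0" if "b \<in> B" for b
      using that by (simp_all add: c_def cinner_scaleC_left cinner_commute[of b])
    have cc: "cinner c c = 1"
      using False by (simp add: cinner_self c_def norm_scaleC norm_divide)
    have "orthonormal_on (insert c B) (\<lambda>b. b)"
      using B(1) cB cc by (auto simp: orthonormal_on_def)
    moreover have "a \<in> cspan (insert c B)"
    proof -
      have "a = complex_of_real (norm w) *\<^sub>C c + proj_op B (\<lambda>b. b) a"
        using w by (simp add: w_def)
      then show ?thesis
        using p complex_vector.span_mono[of B "insert c B"]
        by (metis complex_vector.span_add complex_vector.span_base complex_vector.span_scale insertI1 subsetD subset_insertI)
    qed
    moreover have "A \<subseteq> cspan (insert c B)"
      using B(2) complex_vector.span_mono[of B "insert c B"] by blast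
    moreover have "c \<in> cspan (insert a A)"
    proof -
      have "proj_op B (\<lambda>b. b) a \<in> cspan (insert a A)"
        using p BA complex_vector.span_minimal[OF BA complex_vector.subspace_span] by blast
      then have "w \<in> cspan (insert a A)"
        unfolding w_def by (intro complex_vector.span_diff[OF complex_vector.span_base]) auto
      then show ?thesis unfolding c_def by (rule complex_vector.span_scale)
    qed
    ultimately show ?thesis using BA by (intro exI[of _ "insert c B"]) auto
  qed
qed

text \<open>The first legs of finitely many tensors span a finite-dimensional space, on which its
  projection agrees with the identity.\<close>

lemma act_common_proj:
  assumes "finite (\<U> :: ('h::complex_hilbert, 'e::complex_vector) tensor set)"
  shows "\<exists>B. orthonormal_on B (\<lambda>b. b) \<and> (\<forall>u\<in>\<U>. proj_op B (\<lambda>b. b) \<bullet>\<^sub>m u = u)"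
proof -
  have "\<forall>u :: ('h, 'e) tensor. \<exists>A. finite A \<and> (\<forall>a b. clinear a \<longrightarrow> clinear b \<longrightarrow>
      (\<forall>x\<in>A. a x = b x) \<longrightarrow> a \<bullet>\<^sub>m u = b \<bullet>\<^sub>m u)"
    using act_finitely_determined by blast
  from choice[OF this] obtain A where A: "finite (A u)"
    "clinear a \<Longrightarrow> clinear b \<Longrightarrow> (\<forall>x\<in>A u. a x = b x) \<Longrightarrow> a \<bullet>\<^sub>m u = b \<bullet>\<^sub>m u"
    for a b and u :: "('h, 'e) tensor" by blast
  obtain B :: "'h set" where B: "orthonormal_on B (\<lambda>b. b)" "(\<Union>u\<in>\<U>. A u) \<subseteq> cspan B"
    using gram_schmidt[of "\<Union>u\<in>\<U>. A u"] A(1) assms by blast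
  have "proj_op B (\<lambda>b. b) \<bullet>\<^sub>m u = (\<lambda>z. z) \<bullet>\<^sub>m u" if "u \<in> \<U>" for u
    using that B(2)
    by (intro A(2)[OF clinear_transfer_op clinear_ident] ballI proj_op_span[OF B(1)]) blast
  with B show ?thesis by (auto simp: act_ident)
qed

lemma support_proj:
  assumes "is_support P u"
  shows "\<exists>B. orthonormal_on B (\<lambda>b. b) \<and> (\<forall>b\<in>B. P b = b) \<and> proj_op B (\<lambda>b. b) \<bullet>\<^sub>m u = u"
proof -
  have P: "clinear P" "\<And>z. P (P z) = P z" "P \<bullet>\<^sub>m u = u"
    using assms by (auto simp: is_support_def orth_projection_def bounded_clinear_def fun_eq_iff)
  from act_finitely_determined obtain A where A: "finite A"
    "\<And>a b. clinear a \<Longrightarrow> clinear b \<Longrightarrow> (\<forall>x\<in>A. a x = b x) \<Longrightarrow> a \<bullet>\<^sub>m u = b \<bullet>\<^sub>m u" by metis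
  obtain B where B: "orthonormal_on B (\<lambda>b. b)" "P ` A \<subseteq> cspan B" "B \<subseteq> cspan (P ` A)"
    using gram_schmidt[of "P ` A"] A(1) by blast
  have "P b = b" if "b \<in> cspan (P ` A)" for b
    using that
    by (induction rule: complex_vector.span_induct_alt)
      (auto simp: clinear_zero[OF P(1)] clinear_add[OF P(1)] clinear_scaleC[OF P(1)] P(2))
  moreover have "(\<lambda>z. proj_op B (\<lambda>b. b) (P z)) \<bullet>\<^sub>m u = P \<bullet>\<^sub>m u"
    using B(2) by (intro A(2)[OF clinear_comp[OF clinear_transfer_op P(1)] P(1)] ballI proj_op_span[OF B(1)]) blast
  then have "proj_op B (\<lambda>b. b) \<bullet>\<^sub>m u = u"
    using act_act[OF clinear_transfer_op P(1), of B "\<lambda>b. b" "\<lambda>b. b" u] P(3) by simp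
  ultimately show ?thesis using B by blast
qed

text \<open>Orthogonality of projections becomes a relation between vectors, which isometries and
  \<open>\<diamondsuit>\<close> preserve. It holds because \<open>P k\<close> is self-adjoint: the
  inner product of \<open>b\<close> and \<open>c\<close> equals that of \<open>b\<close> and
  \<open>P k (P l c)\<close>, which is 0.\<close>

lemma pairwise_orthogonal_supports_proj:
  assumes "pairwise_orthogonal_supports n u"
  shows "\<exists>B. (\<forall>k\<in>{1..n}. orthonormal_on (B k) (\<lambda>b. b) \<and> proj_op (B k) (\<lambda>b. b) \<bullet>\<^sub>m u k = u k) \<and>
    (\<forall>k\<in>{1..n}. \<forall>l\<in>{1..n}. k \<noteq> l \<longrightarrow> (\<forall>b\<in>B k. \<forall>c\<in>B l. cinner b c = 0))"
proof -
  obtain P where P: "\<And>k. k \<in> {1..n} \<Longrightarrow> is_support (P k) (u k)"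
    "\<And>k l. k \<in> {1..n} \<Longrightarrow> l \<in> {1..n} \<Longrightarrow> k \<noteq> l \<Longrightarrow> orthogonal_projections (P k) (P l)"
    using assms unfolding pairwise_orthogonal_supports_def by blast
  obtain B where B: "\<And>k. k \<in> {1..n} \<Longrightarrow>
      orthonormal_on (B k) (\<lambda>b. b) \<and> (\<forall>b\<in>B k. P k b = b) \<and> proj_op (B k) (\<lambda>b. b) \<bullet>\<^sub>m u k = u k"
    using support_proj[OF P(1)] by metis
  have "cinner b c = 0" if "k \<in> {1..n}" "l \<in> {1..n}" "k \<noteq> l" "b \<in> B k" "c \<in> B l" for k l b c
  proof -
    have "cinner b c = cinner (P k b) (P l c)" using B that by metis
    also have "\<dots> = cinner b (P k (P l c))"
      using P(1)[OF that(1)] by (simp add: is_support_def orth_projection_def)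
    also have "P k (P l c) = 0"
      using P(2)[OF that(1-3)] by (simp add: orthogonal_projections_def fun_eq_iff)
    finally show ?thesis by (simp add: cinner_zero_right)
  qed
  with B show ?thesis by (intro exI[of _ B]) blast
qed


section \<open>The Hahn--Banach theorem\<close>

text \<open>Homogeneity as an inequality is easier to check for infima. Applied to
  \<open>1/t\<close> it gives equality for positive \<open>t\<close>, and \<open>t = 0\<close> gives
  \<open>q 0 = 0\<close>.\<close>

definition sublinear :: "('e::complex_vector \<Rightarrow> real) \<Rightarrow> bool"
  where "sublinear q \<longleftrightarrow> (\<forall>x y. q (x + y) \<le> q x + q y) \<and>
    (\<forall>t x. 0 \<le> t \<longrightarrow> q (complex_of_real t *\<^sub>C x) \<le> t * q x)"

lemma sublinearD:
  assumes "sublinear q"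
  shows "q (x + y) \<le> q x + q y" "0 \<le> t \<Longrightarrow> q (complex_of_real t *\<^sub>C x) \<le> t * q x" "q 0 = 0"
    "- q (- x) \<le> q x"
proof -
  show add: "q (x + y) \<le> q x + q y" for x y using assms by (simp add: sublinear_def)
  show hom: "0 \<le> t \<Longrightarrow> q (complex_of_real t *\<^sub>C x) \<le> t * q x" for t x using assms by (simp add: sublinear_def)
  show z: "q 0 = 0" using add[of 0 0] hom[of 0 0] by simp
  show "- q (- x) \<le> q x" using add[of x "- x"] z by simp
qed

text \<open>If \<open>q\<close> is minimal among the sublinear functionals, then \<open>sublinear_slope q y = q\<close> for
  all \<open>y\<close>, which makes \<open>q\<close> additive.\<close>

definition sublinear_slope :: "('e::complex_vector \<Rightarrow> real) \<Rightarrow> 'e \<Rightarrow> 'e \<Rightarrow> real"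
  where "sublinear_slope q y x = (INF t\<in>{0..}. q (x + complex_of_real t *\<^sub>C y) - t * q y)"

lemma sublinear_slope_le:
  assumes "sublinear q" "0 \<le> t"
  shows "sublinear_slope q y x \<le> q (x + complex_of_real t *\<^sub>C y) - t * q y"
proof -
  note S = sublinearD[OF assms(1)]
  \<comment> \<open>A lower bound independent of \<open>t\<close>, which makes the infimum a lower
    bound of its members.\<close>
  have "- q (- x) \<le> q (x + complex_of_real t *\<^sub>C y) - t * q y" if t: "0 \<le> t" for t
  proof (cases "t = 0")
    case True
    then show ?thesis using S(4)[of x] by simp
  next
    case False
    have "q y = q (complex_of_real (1/t) *\<^sub>C complex_of_real t *\<^sub>C y)"
      using False by (simp add: scaleC_scaleC scaleC_one)
    also have "\<dots> \<le> 1/t * q (complex_of_real t *\<^sub>C y)" using t by (intro S(2)) simp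
    finally have "t * q y \<le> q (complex_of_real t *\<^sub>C y)" using False t by (simp add: field_simps)
    also have "complex_of_real t *\<^sub>C y = (x + complex_of_real t *\<^sub>C y) + (- x)" by simp
    also have "q \<dots> \<le> q (x + complex_of_real t *\<^sub>C y) + q (- x)" by (rule S(1))
    finally show ?thesis by simp
  qed
  then show ?thesis unfolding sublinear_slope_def using assms(2)
    by (intro cINF_lower bdd_belowI2[where m="- q (- x)"]) auto
qed

text \<open>Parameters \<open>t\<close> for \<open>x\<close> and \<open>s\<close> for
  \<open>x'\<close> combine to \<open>t + s\<close> for the sum; scaling \<open>x\<close> by
  \<open>t\<close> turns the parameter \<open>s\<close> into \<open>t * s\<close>.\<close>

lemma sublinear_sublinear_slope:
  assumes "sublinear q"
  shows "sublinear (sublinear_slope q y)"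
proof -
  note S = sublinearD[OF assms] and L = sublinear_slope_le[OF assms]
  let ?r = "\<lambda>t. complex_of_real t"
  have add: "sublinear_slope q y (x + x') \<le> sublinear_slope q y x + sublinear_slope q y x'" for x x'
  proof -
    have 1: "sublinear_slope q y (x + x') - (q (x + ?r t *\<^sub>C y) - t * q y) \<le> q (x' + ?r s *\<^sub>C y) - s * q y"
      if "0 \<le> t" "0 \<le> s" for t s
    proof -
      have "sublinear_slope q y (x + x') \<le> q (x + x' + ?r (t + s) *\<^sub>C y) - (t + s) * q y"
        using that by (intro L) simp
      also have "x + x' + ?r (t + s) *\<^sub>C y = (x + ?r t *\<^sub>C y) + (x' + ?r s *\<^sub>C y)"
        by (simp add: scaleC_add_left)
      also have "q \<dots> \<le> q (x + ?r t *\<^sub>C y) + q (x' + ?r s *\<^sub>C y)" by (rule S(1))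
      finally show ?thesis by (simp add: algebra_simps)
    qed
    have "sublinear_slope q y (x + x') - (q (x + ?r t *\<^sub>C y) - t * q y) \<le> sublinear_slope q y x'"
      if "0 \<le> t" for t
      unfolding sublinear_slope_def[of q y x'] using 1[OF that] by (intro cINF_greatest) auto
    then have "sublinear_slope q y (x + x') - sublinear_slope q y x' \<le> q (x + ?r t *\<^sub>C y) - t * q y"
      if "0 \<le> t" for t using that by (smt (verit))
    then have "sublinear_slope q y (x + x') - sublinear_slope q y x' \<le> sublinear_slope q y x"
      unfolding sublinear_slope_def[of q y x] by (intro cINF_greatest) auto
    then show ?thesis by simp
  qed
  have hom: "sublinear_slope q y (?r t *\<^sub>C x) \<le> t * sublinear_slope q y x" if "0 \<le> t" for t x
  proof (cases "t = 0")
    case True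
    then show ?thesis using L[of 0 y 0] S(3) by simp
  next
    case False
    have "sublinear_slope q y (?r t *\<^sub>C x) / t \<le> q (x + ?r s *\<^sub>C y) - s * q y" if s: "0 \<le> s" for s
    proof -
      have "sublinear_slope q y (?r t *\<^sub>C x) \<le> q (?r t *\<^sub>C x + ?r (t * s) *\<^sub>C y) - (t * s) * q y"
        using \<open>0 \<le> t\<close> s by (intro L) simp
      also have "?r t *\<^sub>C x + ?r (t * s) *\<^sub>C y = ?r t *\<^sub>C (x + ?r s *\<^sub>C y)"
        by (simp add: scaleC_add_right scaleC_scaleC)
      also have "q \<dots> \<le> t * q (x + ?r s *\<^sub>C y)" using \<open>0 \<le> t\<close> by (rule S(2))
      finally show ?thesis using False \<open>0 \<le> t\<close> by (simp add: field_simps)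
    qed
    then have "sublinear_slope q y (?r t *\<^sub>C x) / t \<le> sublinear_slope q y x"
      unfolding sublinear_slope_def[of q y x] by (intro cINF_greatest) auto
    then show ?thesis using False \<open>0 \<le> t\<close> by (simp add: field_simps)
  qed
  from add hom show ?thesis by (simp add: sublinear_def)
qed

text \<open>Zorn's lemma in the reversed pointwise order. A nonempty chain is bounded by its
  pointwise infimum, which is finite because every member stays above \<open>- p (- x)\<close>, and
  subadditive because two members can both be replaced by the smaller one.\<close>

lemma sublinear_minorant_minimal:
  fixes p :: "'e::complex_vector \<Rightarrow> real"
  assumes p: "sublinear p"
  obtains q where "sublinear q" "q \<le> p" "\<And>r. sublinear r \<Longrightarrow> r \<le> q \<Longrightarrow> r = q"
proof -
  define A where "A = {q. sublinear q \<and> q \<le> p}"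
  have "\<exists>m\<in>A. \<forall>a\<in>A. m \<ge> a \<longrightarrow> a = m"
  proof (rule predicate_Zorn)
    show "partial_order_on A (relation_of (\<ge>) A)"
      by (rule partial_order_on_relation_ofI) auto
    fix C assume C: "C \<in> Chains (relation_of (\<ge>) A)"
    then have CA: "C \<subseteq> A" by (rule Chains_relation_of)
    have tot: "a \<le> b \<or> b \<le> a" if "a \<in> C" "b \<in> C" for a b
      using C that by (auto simp: Chains_def relation_of_def)
    show "\<exists>u\<in>A. \<forall>a\<in>C. a \<ge> u"
    proof (cases "C = {}")
      case True
      then show ?thesis using p by (auto simp: A_def)
    next
      case False
      define u where "u x = (INF a\<in>C. a x)" for x
      have low: "- p (- x) \<le> a x" if "a \<in> C" for a x
      proof -
        have "sublinear a" "a (- x) \<le> p (- x)" using that CA by (auto simp: A_def le_fun_def)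
        then show ?thesis using sublinearD(4)[of a x] by linarith
      qed
      have le: "u x \<le> a x" if "a \<in> C" for a x
        unfolding u_def using that low by (intro cINF_lower bdd_belowI2[where m="- p (- x)"]) auto
      have "sublinear u"
        unfolding sublinear_def
      proof (intro conjI allI impI)
        fix x y
        have "u (x + y) - a x \<le> b y" if ab: "a \<in> C" "b \<in> C" for a b
        proof -
          obtain c where c: "c \<in> C" "c \<le> a" "c \<le> b" using tot[OF ab] ab by auto
          have "u (x + y) \<le> c (x + y)" by (rule le[OF c(1)])
          also have "\<dots> \<le> c x + c y" using c(1) CA by (auto simp: A_def intro: sublinearD)
          also have "\<dots> \<le> a x + b y" using c by (auto simp: le_fun_def intro: add_mono)
          finally show ?thesis by simp
        qed
        then have "u (x + y) - a x \<le> u y" if "a \<in> C" for a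
          unfolding u_def[of y] using that False by (intro cINF_greatest) auto
        then have "u (x + y) - u y \<le> a x" if "a \<in> C" for a
          using that by (smt (verit))
        then have "u (x + y) - u y \<le> u x"
          unfolding u_def[of x] using False by (intro cINF_greatest) auto
        then show "u (x + y) \<le> u x + u y" by simp
      next
        fix t :: real and x assume t: "0 \<le> t"
        have le': "u (complex_of_real t *\<^sub>C x) \<le> t * a x" if "a \<in> C" for a
        proof -
          have "u (complex_of_real t *\<^sub>C x) \<le> a (complex_of_real t *\<^sub>C x)" by (rule le[OF that])
          also have "\<dots> \<le> t * a x" using that CA t by (auto simp: A_def intro: sublinearD)
          finally show ?thesis .
        qed
        show "u (complex_of_real t *\<^sub>C x) \<le> t * u x"
        proof (cases "t = 0")
          case True
          then show ?thesis using le' False by auto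
        next
          case F: False
          have "u (complex_of_real t *\<^sub>C x) / t \<le> u x"
            unfolding u_def[of x] using False F t le'
            by (intro cINF_greatest) (auto simp: field_simps)
          then show ?thesis using F t by (simp add: field_simps)
        qed
      qed
      moreover have "u \<le> p"
      proof (rule le_funI)
        fix x
        obtain a where "a \<in> C" using False by blast
        then show "u x \<le> p x" using le[of a x] CA by (auto simp: A_def le_fun_def intro: order_trans)
      qed
      ultimately show ?thesis using le by (auto simp: A_def le_fun_def)
    qed
  qed
  then obtain q where "q \<in> A" "\<forall>a\<in>A. q \<ge> a \<longrightarrow> a = q" by blast
  then show ?thesis by (intro that[of q]) (auto simp: A_def)
qed

text \<open>The minimal functional is taken below \<open>sublinear_slope p x0\<close> rather than
  \<open>p\<close>: at \<open>- x0\<close> the slope is at most \<open>- p x0\<close> (parameter 1),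
  which forces \<open>f x0 = p x0\<close>.\<close>

theorem hahn_banach_sublinear:
  fixes p :: "'e::complex_vector \<Rightarrow> real"
  assumes p: "sublinear p"
  obtains f where "\<And>x y. f (x + y) = f x + f y" "\<And>t x. f (complex_of_real t *\<^sub>C x) = t * f x"
    "\<And>x. f x \<le> p x" "f x0 = p x0"
proof -
  obtain f where f: "sublinear f" "f \<le> sublinear_slope p x0" "\<And>r. sublinear r \<Longrightarrow> r \<le> f \<Longrightarrow> r = f"
    using sublinear_minorant_minimal[OF sublinear_sublinear_slope[OF p]] by blast
  note S = sublinearD[OF f(1)] and P = sublinearD[OF p]
  have slope: "sublinear_slope f y = f" for y
    using sublinear_slope_le[OF f(1), of 0 y]
    by (intro f(3) sublinear_sublinear_slope f(1)) (auto simp: le_fun_def)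
  \<comment> \<open>Parameter 1 in the slope gives \<open>f x \<le> f (x + y) - f y\<close>, the
    converse of subadditivity.\<close>
  have add: "f (x + y) = f x + f y" for x y
    using sublinear_slope_le[OF f(1), of 1 y x] S(1)[of x y] by (simp add: slope scaleC_one)
  have neg: "f (- x) = - f x" for x
    using add[of x "- x"] S(3) by simp
  have hom0: "f (complex_of_real t *\<^sub>C x) = t * f x" if "0 \<le> t" for t x
    using S(2)[OF that, of x] S(2)[OF that, of "- x"]
    by (simp add: neg complex_vector.scale_minus_right)
  have hom: "f (complex_of_real t *\<^sub>C x) = t * f x" for t x
  proof (cases "0 \<le> t")
    case False
    then have "f (complex_of_real (- t) *\<^sub>C x) = - t * f x" by (intro hom0) simp
    then show ?thesis by (simp add: complex_vector.scale_minus_left neg)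
  qed (rule hom0)
  have le: "f x \<le> p x" for x
    using f(2) sublinear_slope_le[OF p, of 0 x0 x] by (auto simp: le_fun_def intro: order_trans)
  have "f (- x0) \<le> - p x0"
    using f(2) sublinear_slope_le[OF p, of 1 x0 "- x0"] P(3)
    by (auto simp: le_fun_def scaleC_one intro: order_trans)
  then have "f x0 = p x0" using le[of x0] by (simp add: neg)
  with add hom le show ?thesis by (intro that)
qed

lemma hahn_banach_functional:
  fixes p :: "'e::complex_vector \<Rightarrow> real"
  assumes p: "is_norm p" and x0: "x0 \<noteq> 0"
  obtains f :: "'e \<Rightarrow> complex" where "clinear f" "\<And>x. cmod (f x) \<le> p x" "f x0 \<noteq> 0"
proof -
  have "sublinear p" using p by (auto simp: sublinear_def is_norm_def)
  then obtain g where g: "\<And>x y. g (x + y) = g x + g y" "\<And>t x. g (complex_of_real t *\<^sub>C x) = t * g x"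
    "\<And>x. g x \<le> p x" "g x0 = p x0"
    using hahn_banach_sublinear by blast
  \<comment> \<open>The unique complex-linear functional with real part \<open>g\<close>.\<close>
  define f where "f x = Complex (g x) (- g (\<i> *\<^sub>C x))" for x
  have f: "clinear f"
  proof (rule clinearI)
    fix c x y
    show "f (x + y) = f x + f y" by (simp add: f_def g scaleC_add_right complex_eq_iff)
    have gm: "g (- z) = - g z" for z
      using g(2)[of "-1" z] by (simp add: scaleC_one complex_vector.scale_minus_left)
    have 1: "g (c *\<^sub>C x) = Re c * g x + Im c * g (\<i> *\<^sub>C x)" for c x
    proof -
      have "c *\<^sub>C x = complex_of_real (Re c) *\<^sub>C x + complex_of_real (Im c) *\<^sub>C \<i> *\<^sub>C x"
        unfolding scaleC_scaleC scaleC_add_left[symmetric] by (subst complex_eq) (simp add: mult.commute)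
      then show ?thesis by (simp only: g)
    qed
    have 2: "g (\<i> *\<^sub>C \<i> *\<^sub>C x) = - g x"
      by (simp add: scaleC_scaleC complex_vector.scale_minus_left scaleC_one gm)
    have 3: "g (\<i> *\<^sub>C c *\<^sub>C x) = Re c * g (\<i> *\<^sub>C x) - Im c * g x"
      using 1[of c "\<i> *\<^sub>C x"] 2 by (simp add: scaleC_scaleC mult.commute)
    show "f (c *\<^sub>C x) = c *\<^sub>C f x"
      unfolding f_def 3 1[of c x] by (simp add: scaleC_complex_def complex_eq_iff)
  qed
  have "cmod (f x) \<le> p x" for x
  proof -
    obtain c where c: "cmod c = 1" "c * f x = complex_of_real (cmod (f x))"
      using exists_phase by blast
    have "cmod (f x) = Re (f (c *\<^sub>C x))"
      by (simp add: clinear_scaleC[OF f] scaleC_complex_def c)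
    also have "\<dots> \<le> p (c *\<^sub>C x)" by (simp add: f_def g)
    also have "\<dots> = p x" using p c by (simp add: is_norm_def)
    finally show ?thesis .
  qed
  moreover have "f x0 \<noteq> 0"
    using g(4) p x0 by (auto simp: f_def is_norm_def complex_eq_iff)
  ultimately show ?thesis using f that by blast
qed

section \<open>Separating functionals on the algebraic tensor product\<close>

lemma tens_basis_expansion:
  fixes t :: "('e::complex_vector, 'f::complex_vector) tensor"
  assumes C: "complex_vector.independent C" "cspan C = UNIV"
  shows "\<exists>B h. finite B \<and> B \<subseteq> C \<and> t = (\<Sum>b\<in>B. h b \<otimes> b)"
proof (induction t rule: tens_induct)
  case zero
  show ?case by (intro exI[of _ "{}"]) simp
next
  case (add x y t)
  then obtain B h where B: "finite B" "B \<subseteq> C" "t = (\<Sum>b\<in>B. h b \<otimes> b)" by blast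
  let ?r = "complex_vector.representation C y"
  define D where "D = {b. ?r b \<noteq> 0}"
  have D: "finite D" "D \<subseteq> C"
    unfolding D_def using complex_vector.finite_representation complex_vector.representation_ne_zero by blast+
  have "y = (\<Sum>b\<in>D. ?r b *\<^sub>C b)"
    unfolding D_def using complex_vector.sum_nonzero_representation_eq[OF C(1)] C(2) by simp
  then have "x \<otimes> y = (\<Sum>b\<in>D. (?r b *\<^sub>C x) \<otimes> b)"
    using clinear_sum[OF clinear_tens(1), of x "\<lambda>b. ?r b *\<^sub>C b" D] by (simp add: tens_linear)
  also have "\<dots> = (\<Sum>b\<in>B \<union> D. (?r b *\<^sub>C x) \<otimes> b)"
    using B D by (intro sum.mono_neutral_left) (auto simp: D_def tens_linear)
  finally have 1: "x \<otimes> y = (\<Sum>b\<in>B \<union> D. (?r b *\<^sub>C x) \<otimes> b)" .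
  \<comment> \<open>Outside \<open>B\<close> the values of \<open>h\<close> are arbitrary, hence the
    cut-off to 0.\<close>
  have "t = (\<Sum>b\<in>B \<union> D. (if b \<in> B then h b else 0) \<otimes> b)"
    unfolding B(3) using B D by (intro sum.mono_neutral_cong_left) (auto simp: tens_linear)
  with 1 have "x \<otimes> y + t = (\<Sum>b\<in>B \<union> D. (?r b *\<^sub>C x + (if b \<in> B then h b else 0)) \<otimes> b)"
    by (simp add: tens_linear sum.distrib)
  then show ?case using B D by (intro exI[of _ "B \<union> D"]) auto
qed

definition tens_functional ::
    "('e::complex_vector \<Rightarrow> complex) \<Rightarrow> ('f::complex_vector \<Rightarrow> complex) \<Rightarrow> ('e, 'f) tensor \<Rightarrow> complex"
  where "tens_functional f g = tensor_lift (\<lambda>x y. f x * g y)"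

lemma
  assumes "clinear f" "clinear g"
  shows clinear_tens_functional: "clinear (tens_functional f g)"
    and tens_functional_tens: "tens_functional f g (x \<otimes> y) = f x * g y"
proof -
  have "cbilinear (\<lambda>x y. f x * g y)"
    unfolding cbilinear_def
    by (intro conjI allI clinearI)
      (simp_all add: clinear_add[OF assms(1)] clinear_add[OF assms(2)]
        clinear_scaleC[OF assms(1)] clinear_scaleC[OF assms(2)] algebra_simps scaleC_complex_def)
  then show "clinear (tens_functional f g)" "tens_functional f g (x \<otimes> y) = f x * g y"
    by (simp_all add: tens_functional_def clinear_tensor_lift)
qed

text \<open>Hahn-Banach is used twice. With \<open>t\<close> expanded over a basis of the second
  factor, \<open>f\<close> is chosen nonzero at one coefficient; by independence, applying
  \<open>f\<close> to all coefficients leaves a nonzero vector of the second factor, and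
  \<open>g\<close> is chosen nonzero there.\<close>

lemma tens_functional_separates:
  fixes t :: "('e::complex_vector, 'f::complex_vector) tensor"
  assumes p: "is_norm p" and q: "is_norm q" and t: "t \<noteq> 0"
  obtains f g where "clinear f" "\<And>x. cmod (f x) \<le> p x" "clinear g" "\<And>y. cmod (g y) \<le> q y"
    "tens_functional f g t \<noteq> 0"
proof -
  obtain C :: "'f set" where C: "complex_vector.independent C" "cspan C = UNIV"
    using complex_vector.independent_extend_basis[OF complex_vector.independent_empty]
      complex_vector.span_extend_basis[OF complex_vector.independent_empty] by blast
  obtain B h where B: "finite B" "B \<subseteq> C" "t = (\<Sum>b\<in>B. h b \<otimes> b)"
    using tens_basis_expansion[OF C] by blast
  obtain b0 where b0: "b0 \<in> B" "h b0 \<noteq> 0"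
    using t B(3) by (metis (no_types, lifting) sum.neutral tens_linear(6))
  obtain f where f: "clinear f" "\<And>x. cmod (f x) \<le> p x" "f (h b0) \<noteq> 0"
    using hahn_banach_functional[OF p b0(2)] by blast
  have "(\<Sum>b\<in>B. f (h b) *\<^sub>C b) \<noteq> 0"
    using complex_vector.independentD[OF C(1) B(1,2), of "\<lambda>b. f (h b)"] b0 f(3) by blast
  then obtain g where g: "clinear g" "\<And>y. cmod (g y) \<le> q y" "g (\<Sum>b\<in>B. f (h b) *\<^sub>C b) \<noteq> 0"
    using hahn_banach_functional[OF q] by blast
  have "tens_functional f g t = (\<Sum>b\<in>B. f (h b) * g b)"
    by (simp add: B(3) clinear_sum[OF clinear_tens_functional] tens_functional_tens f g)
  also have "\<dots> = g (\<Sum>b\<in>B. f (h b) *\<^sub>C b)"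
    by (simp add: clinear_sum[OF g(1)] clinear_scaleC[OF g(1)] scaleC_complex_def)
  finally show ?thesis using f g that by metis
qed


section \<open>The tensor norm\<close>

lemma diamond_tensor_eq_amplify2: "diamond_tensor D = amplify2 D (\<otimes>)"
  by (simp add: diamond_tensor_def amplify2_def fun_eq_iff)

text \<open>The infimum in \<open>l_norm\<close> need not be attained, so its estimates are proved
  with an excess \<open>\<epsilon>\<close> and passed to the limit.\<close>

lemma at_right_bound:
  fixes f :: "real \<Rightarrow> real"
  assumes "(f \<longlongrightarrow> l) (at_right 0)" "\<And>\<epsilon>. 0 < \<epsilon> \<Longrightarrow> c \<le> f \<epsilon>"
  shows "c \<le> l"
  using assms(1) by (rule tendsto_lowerbound) (auto simp: eventually_at_filter assms(2))

lemma orth_projection_ident: "orth_projection (\<lambda>z. z)"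
  by (simp add: orth_projection_def bounded_clinear_ident fun_eq_iff)

lemma norm_orth_projection_le:
  assumes "orth_projection P"
  shows "norm (P x) \<le> norm x"
proof -
  have "complex_of_real ((norm (P x))\<^sup>2) = cinner x (P x)"
    unfolding cinner_self[symmetric] using assms by (simp add: orth_projection_def fun_eq_iff)
  then have "(norm (P x))\<^sup>2 = cmod (cinner x (P x))"
    by (metis abs_of_nonneg norm_of_real zero_le_power2)
  also have "\<dots> \<le> norm x * norm (P x)" by (rule cmod_cinner_le)
  finally show ?thesis
    by (cases "norm (P x) = 0") (simp_all add: power2_eq_square)
qed

lemma PL_spaceD:
  assumes "PL_space n"
  shows "0 \<le> n u" "n u = 0 \<longleftrightarrow> u = 0" "n (u + v) \<le> n u + n v" "n (c *\<^sub>C u) = cmod c * n u"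
    "bounded_clinear a \<Longrightarrow> n (a \<bullet>\<^sub>m u) \<le> onorm a * n u"
  using assms by (auto simp: PL_space_def is_norm_def)

lemma is_support_scaleC: "is_support P u \<Longrightarrow> is_support P (c *\<^sub>C u)"
  by (auto simp: is_support_def orth_projection_def act_scaleC bounded_clinear_clinear)

text \<open>\<open>s\<close> bounds the square of the expression under the infimum in the case \<open>a = 1\<close>.\<close>

definition diamond_sum ::
    "('h::complex_hilbert \<Rightarrow> 'h \<Rightarrow> 'h) \<Rightarrow>
     (('h, 'e::complex_vector) tensor \<Rightarrow> real) \<Rightarrow> (('h, 'f::complex_vector) tensor \<Rightarrow> real) \<Rightarrow>
     ('h, ('e, 'f) tensor) tensor \<Rightarrow> real \<Rightarrow> bool"
  where "diamond_sum D nE nF W s \<longleftrightarrow> (\<exists>n u v. pairwise_orthogonal_supports n u \<and>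
    W = (\<Sum>k = 1..n. diamond_tensor D (u k) (v k)) \<and>
    (\<Sum>k = 1..n. (nE (u k))\<^sup>2 * (nF (v k))\<^sup>2) \<le> s)"

text \<open>\<open>cinner_D\<close> combines the inner product of the Hilbert tensor product with
  the unitarity of \<open>\<iota>\<close>. The orthonormal pair comes from infinite dimension and
  supplies the two isometries that merge two representations at a time.\<close>

locale diamond_product =
  fixes D :: "'h::complex_hilbert \<Rightarrow> 'h \<Rightarrow> 'h"
  assumes cbilinear_D: "cbilinear D"
    and cinner_D: "cinner (D \<xi> \<eta>) (D \<xi>' \<eta>') = cinner \<xi> \<xi>' * cinner \<eta> \<eta>'"
    and orthonormal_pair: "\<exists>e :: bool \<Rightarrow> 'h. orthonormal_on UNIV e"
begin

lemma cbilinear_diamond_tensor: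
  "cbilinear (diamond_tensor D :: ('h, 'e::complex_vector) tensor \<Rightarrow> ('h, 'f::complex_vector) tensor \<Rightarrow> _)"
  unfolding diamond_tensor_eq_amplify2 by (rule cbilinear_amplify2[OF cbilinear_D cbilinear_tens])

lemmas D_linear = cbilinearD[OF cbilinear_D]

lemma unit_vector:
  obtains e :: 'h where "cinner e e = 1" "norm e = 1"
proof -
  obtain e :: "bool \<Rightarrow> 'h" where "orthonormal_on UNIV e" using orthonormal_pair by blast
  then have "cinner (e True) (e True) = 1" by (simp add: orthonormal_on_def)
  with norm_eq_1_cinner that show ?thesis by blast
qed

lemma norm_D: "norm (D \<xi> \<eta>) = norm \<xi> * norm \<eta>"
proof -
  have "complex_of_real ((norm (D \<xi> \<eta>))\<^sup>2) = complex_of_real ((norm \<xi> * norm \<eta>)\<^sup>2)"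
    unfolding cinner_self[symmetric] cinner_D by (simp add: cinner_self power_mult_distrib)
  then have "(norm (D \<xi> \<eta>))\<^sup>2 = (norm \<xi> * norm \<eta>)\<^sup>2" by (simp only: of_real_eq_iff)
  then show ?thesis by (simp add: power2_eq_iff_nonneg)
qed

lemma orthonormal_D:
  assumes "orthonormal_on X e" "orthonormal_on Y f"
  shows "orthonormal_on (X \<times> Y) (\<lambda>(x, y). D (e x) (f y))"
  using assms by (auto simp: orthonormal_on_def cinner_D)

lemma transfer_op_D:
  "transfer_op (X \<times> Y) (\<lambda>(x, y). D (e x) (f y)) (\<lambda>(x, y). D (g x) (h y)) (D \<xi> \<eta>)
    = D (transfer_op X e g \<xi>) (transfer_op Y f h \<eta>)"
proof -
  have "D (\<Sum>x\<in>X. a x) (\<Sum>y\<in>Y. b y) = (\<Sum>x\<in>X. \<Sum>y\<in>Y. D (a x) (b y))" for a b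
    by (simp only: clinear_sum[OF D_linear(2)]) (simp only: clinear_sum[OF D_linear(1)])
  then show ?thesis
    unfolding transfer_op_def
    by (simp add: sum.cartesian_product' clinear_scaleC[OF D_linear(1)] clinear_scaleC[OF D_linear(2)]
        scaleC_scaleC cinner_D mult.commute)
qed

text \<open>The law (a \<diamondsuit> b) \<cdot> (u \<diamondsuit> v) = (a \<cdot> u) \<diamondsuit>
  (b \<cdot> v) for finite rank a and b, where a \<diamondsuit> b is simply the transfer operator of
  the product families.\<close>

lemma transfer_op_amplify2:
  assumes R: "cbilinear R"
  shows "transfer_op (X \<times> Y) (\<lambda>(x, y). D (e x) (f y)) (\<lambda>(x, y). D (g x) (h y)) \<bullet>\<^sub>m amplify2 D R u v
    = amplify2 D R (transfer_op X e g \<bullet>\<^sub>m u) (transfer_op Y f h \<bullet>\<^sub>m v)"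
proof (rule cbilinear_tens_ext[where s=u and t=v])
  note bil = cbilinear_amplify2[OF cbilinear_D R]
  let ?T = "transfer_op (X \<times> Y) (\<lambda>(x, y). D (e x) (f y)) (\<lambda>(x, y). D (g x) (h y))"
  show "cbilinear (\<lambda>u v. ?T \<bullet>\<^sub>m amplify2 D R u v)"
    using cbilinear_compose[OF bil clinear_ident clinear_ident clinear_act[OF clinear_transfer_op]] .
  show "cbilinear (\<lambda>u v. amplify2 D R (transfer_op X e g \<bullet>\<^sub>m u) (transfer_op Y f h \<bullet>\<^sub>m v))"
    using cbilinear_compose[OF bil clinear_act[OF clinear_transfer_op]
      clinear_act[OF clinear_transfer_op] clinear_ident] .
qed (simp add: amplify2_tens[OF cbilinear_D R] act_tens clinear_transfer_op transfer_op_D)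

end

locale PL_tensor_product = diamond_product D
  for D :: "'h::complex_hilbert \<Rightarrow> 'h \<Rightarrow> 'h" +
  fixes nE :: "('h, 'e::complex_vector) tensor \<Rightarrow> real"
    and nF :: "('h, 'f::complex_vector) tensor \<Rightarrow> real"
  assumes E: "PL_space nE" and F: "PL_space nF"
begin

section \<open>Diamond sums: scaling, merging and existence\<close>

lemma diamond_sum_nonneg: "diamond_sum D nE nF W s \<Longrightarrow> 0 \<le> s"
  unfolding diamond_sum_def
  by (elim exE conjE) (rule order_trans[rotated], assumption, simp add: sum_nonneg)

lemma diamond_sum_mono: "diamond_sum D nE nF W s \<Longrightarrow> s \<le> t \<Longrightarrow> diamond_sum D nE nF W t"
  unfolding diamond_sum_def by (blast intro: order_trans)

lemma diamond_sum_zero: "0 \<le> s \<Longrightarrow> diamond_sum D nE nF 0 s"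
  unfolding diamond_sum_def
  by (intro exI[of _ 0]) (simp add: pairwise_orthogonal_supports_def)

lemma diamond_sum_single: "diamond_sum D nE nF (diamond_tensor D u v) ((nE u)\<^sup>2 * (nF v)\<^sup>2)"
  unfolding diamond_sum_def
  by (intro exI[of _ 1] exI[of _ "\<lambda>_. u"] exI[of _ "\<lambda>_. v"])
    (auto simp: pairwise_orthogonal_supports_def is_support_def act_ident
      intro!: exI[of _ "\<lambda>_ z. z"] orth_projection_ident)

lemma diamond_sum_scaleC:
  assumes "diamond_sum D nE nF W s"
  shows "diamond_sum D nE nF (c *\<^sub>C W) ((cmod c)\<^sup>2 * s)"
proof -
  obtain n u v where 1: "pairwise_orthogonal_supports n u"
    "W = (\<Sum>k = 1..n. diamond_tensor D (u k) (v k))"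
    "(\<Sum>k = 1..n. (nE (u k))\<^sup>2 * (nF (v k))\<^sup>2) \<le> s"
    using assms unfolding diamond_sum_def by blast
  have "pairwise_orthogonal_supports n (\<lambda>k. c *\<^sub>C u k)"
    using 1(1) unfolding pairwise_orthogonal_supports_def by (meson is_support_scaleC)
  moreover have "c *\<^sub>C W = (\<Sum>k = 1..n. diamond_tensor D (c *\<^sub>C u k) (v k))"
    by (simp add: 1(2) complex_vector.scale_sum_right
        clinear_scaleC[OF cbilinearD(2)[OF cbilinear_diamond_tensor]])
  moreover have "(\<Sum>k = 1..n. (nE (c *\<^sub>C u k))\<^sup>2 * (nF (v k))\<^sup>2) =
      (cmod c)\<^sup>2 * (\<Sum>k = 1..n. (nE (u k))\<^sup>2 * (nF (v k))\<^sup>2)"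
    by (simp add: PL_spaceD(4)[OF E] power_mult_distrib sum_distrib_left mult.assoc)
  then have "(\<Sum>k = 1..n. (nE (c *\<^sub>C u k))\<^sup>2 * (nF (v k))\<^sup>2) \<le> (cmod c)\<^sup>2 * s"
    using 1(3) by (simp add: mult_left_mono)
  ultimately show ?thesis unfolding diamond_sum_def by blast
qed

text \<open>Left multiplication by two orthonormal vectors gives isometries \<open>S i\<close> with orthogonal ranges.
  Moving \<open>W\<close> and \<open>W'\<close> into them makes all supports orthogonal.  On the finitely many vectors
  involved, the adjoints of \<open>S i \<diamondsuit> 1\<close> are replaced by finite rank operators.\<close>

lemma diamond_sum_combine:
  assumes "diamond_sum D nE nF W s" "diamond_sum D nE nF W' t"
  obtains T1 T2 W'' where "bounded_clinear T1" "bounded_clinear T2"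
    "\<And>z. (norm (T1 z))\<^sup>2 + (norm (T2 z))\<^sup>2 \<le> (norm z)\<^sup>2"
    "diamond_sum D nE nF W'' (s + t)" "T1 \<bullet>\<^sub>m W'' = W" "T2 \<bullet>\<^sub>m W'' = W'"
proof -
  obtain n u v where 1: "pairwise_orthogonal_supports n u"
    "W = (\<Sum>k = 1..n. diamond_tensor D (u k) (v k))"
    "(\<Sum>k = 1..n. (nE (u k))\<^sup>2 * (nF (v k))\<^sup>2) \<le> s"
    using assms(1) unfolding diamond_sum_def by blast
  obtain m u' v' where 2: "pairwise_orthogonal_supports m u'"
    "W' = (\<Sum>k = 1..m. diamond_tensor D (u' k) (v' k))"
    "(\<Sum>k = 1..m. (nE (u' k))\<^sup>2 * (nF (v' k))\<^sup>2) \<le> t"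
    using assms(2) unfolding diamond_sum_def by blast
  obtain B where B: "\<And>k. k \<in> {1..n} \<Longrightarrow> orthonormal_on (B k) (\<lambda>b. b)"
      "\<And>k. k \<in> {1..n} \<Longrightarrow> proj_op (B k) (\<lambda>b. b) \<bullet>\<^sub>m u k = u k"
      "\<And>k l b c. k \<in> {1..n} \<Longrightarrow> l \<in> {1..n} \<Longrightarrow> k \<noteq> l \<Longrightarrow> b \<in> B k \<Longrightarrow> c \<in> B l \<Longrightarrow> cinner b c = 0"
    using pairwise_orthogonal_supports_proj[OF 1(1)] by blast
  obtain B' where B': "\<And>k. k \<in> {1..m} \<Longrightarrow> orthonormal_on (B' k) (\<lambda>b. b)"
      "\<And>k. k \<in> {1..m} \<Longrightarrow> proj_op (B' k) (\<lambda>b. b) \<bullet>\<^sub>m u' k = u' k"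
      "\<And>k l b c. k \<in> {1..m} \<Longrightarrow> l \<in> {1..m} \<Longrightarrow> k \<noteq> l \<Longrightarrow> b \<in> B' k \<Longrightarrow> c \<in> B' l \<Longrightarrow> cinner b c = 0"
    using pairwise_orthogonal_supports_proj[OF 2(1)] by blast
  \<comment> \<open>\<open>B\<close> and \<open>B'\<close> record the orthogonality inside each
    representation but are unrelated to each other. \<open>X\<close> and \<open>Y\<close> are common
    bases for all first and all second factors, on which the operators \<open>T i\<close> can be
    written down.\<close>
  obtain X where X: "orthonormal_on X (\<lambda>b. b)"
    "\<And>k. k \<in> {1..n} \<Longrightarrow> proj_op X (\<lambda>b. b) \<bullet>\<^sub>m u k = u k"
    "\<And>k. k \<in> {1..m} \<Longrightarrow> proj_op X (\<lambda>b. b) \<bullet>\<^sub>m u' k = u' k"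
    using act_common_proj[of "u ` {1..n} \<union> u' ` {1..m}"] by auto
  obtain Y where Y: "orthonormal_on Y (\<lambda>b. b)"
    "\<And>k. k \<in> {1..n} \<Longrightarrow> proj_op Y (\<lambda>b. b) \<bullet>\<^sub>m v k = v k"
    "\<And>k. k \<in> {1..m} \<Longrightarrow> proj_op Y (\<lambda>b. b) \<bullet>\<^sub>m v' k = v' k"
    using act_common_proj[of "v ` {1..n} \<union> v' ` {1..m}"] by auto
  obtain e :: "bool \<Rightarrow> 'h" where e: "orthonormal_on UNIV e"
    using orthonormal_pair by blast
  define S where "S i = D (e i)" for i
  have S_lin: "clinear (S i)" for i
    unfolding S_def by (rule D_linear)
  have S_inner: "cinner (S i x) (S j y) = (if i = j then cinner x y else 0)" for i j x y
    using e by (simp add: S_def cinner_D orthonormal_on_def)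
  have S_norm: "norm (S i x) = norm x" for i x
    using S_inner[of i x i x] by (simp add: cinner_self flip: of_real_power)
  have S_bdd: "bounded_clinear (S i)" for i
    by (rule bounded_clinearI[where K=1]) (simp_all add: S_lin S_norm)
  have S_onorm: "onorm (S i) \<le> 1" for i
    by (rule onorm_bound) (simp_all add: S_norm)
  have nS: "nE (S i \<bullet>\<^sub>m x) \<le> nE x" for i x
    using PL_spaceD(5)[OF E S_bdd, of i x] mult_right_mono[OF S_onorm PL_spaceD(1)[OF E], of i x]
    by simp
  have nS2: "(nE (S i \<bullet>\<^sub>m x))\<^sup>2 * (nF y)\<^sup>2 \<le> (nE x)\<^sup>2 * (nF y)\<^sup>2" for i x y
    by (intro mult_right_mono power_mono nS PL_spaceD(1)[OF E]) simp
  have S_orth: "orthonormal_on C (S i)" if "orthonormal_on C (\<lambda>b. b)" for C i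
    using that by (auto simp: orthonormal_on_def S_inner)
  have S_supp: "is_support (proj_op C (S i)) (S i \<bullet>\<^sub>m x)"
    if "orthonormal_on C (\<lambda>b. b)" "proj_op C (\<lambda>b. b) \<bullet>\<^sub>m x = x" for C i and x :: "('h, 'e) tensor"
  proof -
    have "(\<lambda>z. proj_op C (S i) (S i z)) = (\<lambda>z. S i (proj_op C (\<lambda>b. b) z))"
      unfolding transfer_op_def by (simp add: S_inner clinear_sum[OF S_lin] clinear_scaleC[OF S_lin])
    then have "proj_op C (S i) \<bullet>\<^sub>m S i \<bullet>\<^sub>m x = S i \<bullet>\<^sub>m proj_op C (\<lambda>b. b) \<bullet>\<^sub>m x"
      by (simp add: act_act S_lin clinear_transfer_op)
    then show ?thesis
      by (simp add: is_support_def orth_projection_proj_op S_orth that)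
  qed
  have S_orthog: "orthogonal_projections (proj_op C (S i)) (proj_op C' (S j))"
    if "i \<noteq> j \<or> (\<forall>b\<in>C'. \<forall>c\<in>C. cinner b c = 0)" for C C' i j
    using that by (intro orthogonal_projections_proj_op) (auto simp: S_inner)
  \<comment> \<open>The adjoint of \<open>S i \<diamondsuit> 1\<close>, cut down to \<open>X\<close>
    and \<open>Y\<close>: it takes \<open>D (S i x) y\<close> to \<open>D x y\<close>.\<close>
  define T where "T i = transfer_op (X \<times> Y) (\<lambda>(x, y). D (S i x) y) (\<lambda>(x, y). D x y)" for i
  \<comment> \<open>The sources of \<open>T True\<close> and \<open>T False\<close> together form a
    single orthonormal family, so one application of Bessel's inequality bounds both norms at
    once.\<close>
  have "orthonormal_on (UNIV \<times> X) (\<lambda>(i, x). S i x)"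
    using orthonormal_D[OF e X(1)] by (simp add: S_def)
  then have "orthonormal_on ((UNIV \<times> X) \<times> Y) (\<lambda>(ix, y). D ((\<lambda>(i, x). S i x) ix) y)"
    by (rule orthonormal_D) (rule Y)
  note SS = bessel[OF this]
  have DXY: "orthonormal_on (X \<times> Y) (\<lambda>(x, y). D x y)"
    using orthonormal_D[OF X(1) Y(1)] .
  have T_norm: "(norm (T True z))\<^sup>2 + (norm (T False z))\<^sup>2 \<le> (norm z)\<^sup>2" for z
  proof -
    have "(norm (T True z))\<^sup>2 + (norm (T False z))\<^sup>2 = (\<Sum>i\<in>UNIV. (norm (T i z))\<^sup>2)"
      by (simp add: UNIV_bool)
    also have "\<dots> = (\<Sum>i\<in>UNIV. \<Sum>x\<in>X. \<Sum>y\<in>Y. (cmod (cinner z (D (S i x) y)))\<^sup>2)"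
      by (simp add: T_def norm_transfer_op[OF DXY] sum.cartesian_product')
    also have "\<dots> = (\<Sum>p\<in>(UNIV \<times> X) \<times> Y. (cmod (cinner z ((\<lambda>(ix, y). D ((\<lambda>(i, x). S i x) ix) y) p)))\<^sup>2)"
      by (simp add: sum.cartesian_product')
    also have "\<dots> \<le> (norm z)\<^sup>2" by (rule SS)
    finally show ?thesis .
  qed
  have T_bdd: "bounded_clinear (T i)" for i
    unfolding T_def
    by (intro bounded_clinear_transfer_op DXY orthonormal_D[OF S_orth[OF X(1)] Y(1)])
  have T_lin: "clinear (T i)" for i by (rule bounded_clinear_clinear[OF T_bdd])
  \<comment> \<open>The truncated adjoint of \<open>S i\<close> undoes \<open>S i\<close> up to the
    projection onto the span of \<open>X\<close>, and kills the range of the other isometry.\<close>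
  have XS: "transfer_op X (S i) (\<lambda>b. b) \<bullet>\<^sub>m S j \<bullet>\<^sub>m x =
      (if i = j then proj_op X (\<lambda>b. b) \<bullet>\<^sub>m x else 0)" for i j and x :: "('h, 'e) tensor"
  proof -
    have "transfer_op X (S i) (\<lambda>b. b) \<bullet>\<^sub>m S j \<bullet>\<^sub>m x = (\<lambda>z. transfer_op X (S i) (\<lambda>b. b) (S j z)) \<bullet>\<^sub>m x"
      by (intro act_act clinear_transfer_op S_lin)
    also have "(\<lambda>z. transfer_op X (S i) (\<lambda>b. b) (S j z)) =
        (\<lambda>z. (if i = j then 1 else 0) *\<^sub>C proj_op X (\<lambda>b. b) z)"
      by (auto simp: transfer_op_def S_inner scaleC_one)
    finally show ?thesis by (simp add: act_scale clinear_transfer_op scaleC_one)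
  qed
  have T_act: "T i \<bullet>\<^sub>m diamond_tensor D (S j \<bullet>\<^sub>m x) y = (if i = j then diamond_tensor D x y else 0)"
    if "proj_op X (\<lambda>b. b) \<bullet>\<^sub>m x = x" "proj_op Y (\<lambda>b. b) \<bullet>\<^sub>m y = y"
    for i j and x :: "('h, 'e) tensor" and y :: "('h, 'f) tensor"
    using transfer_op_amplify2[OF cbilinear_tens, of X Y "S i" "\<lambda>b. b" "\<lambda>b. b" "\<lambda>b. b" "S j \<bullet>\<^sub>m x" y]
    by (simp add: T_def XS that clinear_zero[OF cbilinearD(2)[OF cbilinear_diamond_tensor]]
        flip: diamond_tensor_eq_amplify2)
  \<comment> \<open>Indices \<open>1..n\<close> carry the first representation moved by
    \<open>S True\<close>, indices \<open>n + 1..n + m\<close> the second moved by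
    \<open>S False\<close>.\<close>
  define w where "w k = (if k \<le> n then S True \<bullet>\<^sub>m u k else S False \<bullet>\<^sub>m u' (k - n))" for k
  define x where "x k = (if k \<le> n then v k else v' (k - n))" for k
  define P where "P k = (if k \<le> n then proj_op (B k) (S True) else proj_op (B' (k - n)) (S False))" for k
  define W'' where "W'' = (\<Sum>k = 1..n + m. diamond_tensor D (w k) (x k))"
  have split: "(\<Sum>k = 1..n + m. g k) = (\<Sum>k = 1..n. g k) + (\<Sum>k = 1..m. g (k + n))"
    for g :: "nat \<Rightarrow> 'z::comm_monoid_add"
    using sum.ub_add_nat[of 1 n g m] sum.shift_bounds_cl_nat_ivl[of g 1 n m] by (simp add: add.commute)
  have W'': "W'' = (\<Sum>k = 1..n. diamond_tensor D (S True \<bullet>\<^sub>m u k) (v k)) +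
      (\<Sum>k = 1..m. diamond_tensor D (S False \<bullet>\<^sub>m u' k) (v' k))"
    unfolding W''_def split by (intro arg_cong2[of _ _ _ _ "(+)"] sum.cong) (auto simp: w_def x_def)
  have supp: "is_support (P k) (w k)" if "k \<in> {1..n + m}" for k
  proof (cases "k \<le> n")
    case True
    then show ?thesis using that B(1,2)[of k] by (auto simp: P_def w_def intro!: S_supp)
  next
    case False
    then have "k - n \<in> {1..m}" using that by auto
    then show ?thesis using False S_supp[OF B'(1,2)[of "k - n"]] by (simp add: P_def w_def)
  qed
  have orth: "orthogonal_projections (P k) (P l)" if kl: "k \<in> {1..n + m}" "l \<in> {1..n + m}" "k \<noteq> l" for k l
  proof (cases "k \<le> n"; cases "l \<le> n")
    assume "k \<le> n" "l \<le> n"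
    then show ?thesis using kl B(3)[of l k] by (auto simp: P_def intro!: S_orthog)
  next
    assume "\<not> k \<le> n" "\<not> l \<le> n"
    then have *: "k - n \<in> {1..m}" "l - n \<in> {1..m}" "l - n \<noteq> k - n" using kl by auto
    show ?thesis using \<open>\<not> k \<le> n\<close> \<open>\<not> l \<le> n\<close> B'(3)[OF *(2,1,3)] by (auto simp: P_def intro!: S_orthog)
  \<comment> \<open>The two mixed cases: the ranges of \<open>S True\<close> and
    \<open>S False\<close> are orthogonal, whatever the bases.\<close>
  qed (auto simp: P_def intro!: S_orthog)
  have "pairwise_orthogonal_supports (n + m) w"
    unfolding pairwise_orthogonal_supports_def using supp orth by blast
  moreover have "(\<Sum>k = 1..n + m. (nE (w k))\<^sup>2 * (nF (x k))\<^sup>2) \<le> s + t"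
  proof -
    have "(\<Sum>k = 1..n + m. (nE (w k))\<^sup>2 * (nF (x k))\<^sup>2) =
        (\<Sum>k = 1..n. (nE (S True \<bullet>\<^sub>m u k))\<^sup>2 * (nF (v k))\<^sup>2) +
        (\<Sum>k = 1..m. (nE (S False \<bullet>\<^sub>m u' k))\<^sup>2 * (nF (v' k))\<^sup>2)"
      unfolding split by (intro arg_cong2[of _ _ _ _ "(+)"] sum.cong) (auto simp: w_def x_def)
    also have "\<dots> \<le> s + t"
      by (intro add_mono order_trans[OF sum_mono 1(3)] order_trans[OF sum_mono 2(3)] nS2)
    finally show ?thesis .
  qed
  ultimately have osum: "diamond_sum D nE nF W'' (s + t)"
    unfolding diamond_sum_def W''_def by blast
  have sum1: "T i \<bullet>\<^sub>m W'' = (\<Sum>k = 1..n. T i \<bullet>\<^sub>m diamond_tensor D (S True \<bullet>\<^sub>m u k) (v k)) +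
      (\<Sum>k = 1..m. T i \<bullet>\<^sub>m diamond_tensor D (S False \<bullet>\<^sub>m u' k) (v' k))" for i
    unfolding W'' act_add[OF T_lin] by (simp only: clinear_sum[OF clinear_act[OF T_lin]])
  have "T True \<bullet>\<^sub>m W'' = W" "T False \<bullet>\<^sub>m W'' = W'"
    unfolding sum1 1(2) 2(2) by (simp_all add: T_act X Y)
  then show ?thesis using T_bdd T_norm osum that by blast
qed

text \<open>This makes the set under the infimum nonempty. Sums are merged by
  \<open>diamond_sum_combine\<close>, so elementary tensors are enough.\<close>

lemma diamond_sum_representation:
  "\<exists>a W s. bounded_clinear a \<and> diamond_sum D nE nF W s \<and> U = a \<bullet>\<^sub>m W"
proof -
  let ?R = "\<lambda>U. \<exists>a W s. bounded_clinear a \<and> diamond_sum D nE nF W s \<and> U = a \<bullet>\<^sub>m W"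
  have zero: "?R 0"
    using diamond_sum_zero[of 0] bounded_clinear_ident act_ident by (metis order_refl)
  have plus: "?R (U + V)" if U: "?R U" and V: "?R V" for U V
  proof -
    obtain a W s where a: "bounded_clinear a" "diamond_sum D nE nF W s" "U = a \<bullet>\<^sub>m W"
      using U by blast
    obtain b W' t where b: "bounded_clinear b" "diamond_sum D nE nF W' t" "V = b \<bullet>\<^sub>m W'"
      using V by blast
    obtain T1 T2 W'' where T: "bounded_clinear T1" "bounded_clinear T2"
      "diamond_sum D nE nF W'' (s + t)" "T1 \<bullet>\<^sub>m W'' = W" "T2 \<bullet>\<^sub>m W'' = W'"
      using diamond_sum_combine[OF a(2) b(2)] by metis
    note lin = a(1)[THEN bounded_clinear_clinear] b(1)[THEN bounded_clinear_clinear]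
      T(1,2)[THEN bounded_clinear_clinear]
    have "U + V = (\<lambda>z. a (T1 z) + b (T2 z)) \<bullet>\<^sub>m W''"
      by (simp add: act_plus clinear_comp lin a(3) b(3) T(4,5)[symmetric] act_act)
    moreover have "bounded_clinear (\<lambda>z. a (T1 z) + b (T2 z))"
      by (rule bounded_clinear_plus[OF bounded_clinear_comp[OF a(1) T(1)] bounded_clinear_comp[OF b(1) T(2)]])
    ultimately show ?thesis using T(3) by blast
  qed
  have elem: "?R (z \<otimes> x \<otimes> y)" for z x y
  proof -
    obtain e :: 'h where e: "cinner e e = 1" "norm e = 1" by (rule unit_vector)
    \<comment> \<open>The rank one operator taking the unit vector \<open>D e e\<close> to
      \<open>z\<close>: it turns the diamond of \<open>e \<otimes> x\<close> and
      \<open>e \<otimes> y\<close> into \<open>z \<otimes> x \<otimes> y\<close>.\<close>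
    define a where "a w = cinner w (D e e) *\<^sub>C z" for w
    have "clinear a" unfolding a_def[abs_def] by (intro clinear_scale_left clinear_cinner)
    moreover have "norm (a w) \<le> norm z * norm w" for w
      using mult_right_mono[OF cmod_cinner_le[of w "D e e"] norm_ge_zero[of z]]
      by (simp add: a_def norm_scaleC norm_D e mult.commute)
    ultimately have a: "bounded_clinear a" by (rule bounded_clinearI)
    have "z \<otimes> x \<otimes> y = a \<bullet>\<^sub>m diamond_tensor D (e \<otimes> x) (e \<otimes> y)"
      using bounded_clinear_clinear[OF a]
      by (simp add: diamond_tensor_tens cbilinear_D act_tens a_def cinner_D e scaleC_one)
    then show ?thesis using a diamond_sum_single by blast
  qed
  have tens: "?R (z \<otimes> t)" for z t
  proof (induction t rule: tens_induct)
    case zero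
    show ?case using \<open>?R 0\<close> by (simp add: tens_linear)
  next
    case (add x y t)
    then show ?case using plus[OF elem add] by (simp add: tens_linear)
  qed
  show ?thesis
  proof (induction U rule: tens_induct)
    case (add x y t)
    show ?case by (rule plus[OF tens add])
  qed (rule zero)
qed

section \<open>The seminorm axioms and the inequality for orthogonal supports\<close>

abbreviation nl :: "('h, ('e, 'f) tensor) tensor \<Rightarrow> real"
  where "nl \<equiv> l_norm D nE nF"

lemma l_norm_values:
  "{onorm a * sqrt (\<Sum>k = 1..n. (nE (u k))\<^sup>2 * (nF (v k))\<^sup>2) | n a u v.
      bounded_clinear a \<and> pairwise_orthogonal_supports n u \<and>
      U = a \<bullet>\<^sub>m (\<Sum>k = 1..n. diamond_tensor D (u k) (v k))} \<noteq> {}"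
  using diamond_sum_representation[of U] unfolding diamond_sum_def by blast

lemma l_norm_nonneg: "0 \<le> nl U"
  unfolding l_norm_def
  by (rule cInf_greatest[OF l_norm_values]) (auto intro!: mult_nonneg_nonneg onorm_nonneg sum_nonneg)

lemma l_norm_le:
  assumes "bounded_clinear a" "diamond_sum D nE nF W s"
  shows "nl (a \<bullet>\<^sub>m W) \<le> onorm a * sqrt s"
proof -
  obtain n u v where 1: "pairwise_orthogonal_supports n u"
    "W = (\<Sum>k = 1..n. diamond_tensor D (u k) (v k))"
    "(\<Sum>k = 1..n. (nE (u k))\<^sup>2 * (nF (v k))\<^sup>2) \<le> s"
    using assms(2) unfolding diamond_sum_def by blast
  have "nl (a \<bullet>\<^sub>m W) \<le> onorm a * sqrt (\<Sum>k = 1..n. (nE (u k))\<^sup>2 * (nF (v k))\<^sup>2)"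
    unfolding l_norm_def using 1 assms(1)
    by (intro cInf_lower bdd_belowI[where m=0])
      (auto intro!: mult_nonneg_nonneg onorm_nonneg sum_nonneg)
  also have "\<dots> \<le> onorm a * sqrt s"
    using 1(3) by (intro mult_left_mono onorm_nonneg assms(1)) simp
  finally show ?thesis .
qed

text \<open>A normal form with a contractive outer operator: the factor \<open>onorm a\<close> is
  moved into the sum. If it vanishes, then \<open>U = 0\<close> and the empty sum serves.\<close>

lemma l_norm_approx:
  assumes "nl U < r"
  obtains a W where "bounded_clinear a" "\<And>z. norm (a z) \<le> norm z" "diamond_sum D nE nF W (r\<^sup>2)"
    "U = a \<bullet>\<^sub>m W"
proof -
  obtain x where "x < r" "x \<in> {onorm a * sqrt (\<Sum>k = 1..n. (nE (u k))\<^sup>2 * (nF (v k))\<^sup>2) | n a u v.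
      bounded_clinear a \<and> pairwise_orthogonal_supports n u \<and>
      U = a \<bullet>\<^sub>m (\<Sum>k = 1..n. diamond_tensor D (u k) (v k))}"
    using cInf_lessD[OF l_norm_values assms[unfolded l_norm_def]] by blast
  then obtain a W s where a: "bounded_clinear a" "diamond_sum D nE nF W s" "U = a \<bullet>\<^sub>m W"
    "onorm a * sqrt s < r"
    unfolding diamond_sum_def by blast
  note lin = bounded_clinear_clinear[OF a(1)]
  show ?thesis
  proof (cases "onorm a = 0")
    case True
    then have "norm (a z) \<le> 0" for z using norm_le_onorm[OF a(1), of z] by simp
    then have "a = (\<lambda>z. 0 *\<^sub>C z)" by auto
    then have "U = (\<lambda>z. z) \<bullet>\<^sub>m 0"
      using act_scale[OF clinear_ident, of 0 W] by (simp add: a(3) act_ident)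
    then show ?thesis
      by (intro that[of "\<lambda>z. z" 0] bounded_clinear_ident diamond_sum_zero) auto
  next
    case False
    let ?\<alpha> = "onorm a"
    have pos: "0 < ?\<alpha>" using False onorm_nonneg[OF a(1)] by simp
    show ?thesis
    proof (rule that[of "\<lambda>z. complex_of_real (1 / ?\<alpha>) *\<^sub>C a z" "complex_of_real ?\<alpha> *\<^sub>C W"])
      show "bounded_clinear (\<lambda>z. complex_of_real (1 / ?\<alpha>) *\<^sub>C a z)" by (rule bounded_clinear_scale[OF a(1)])
      show "norm (complex_of_real (1 / ?\<alpha>) *\<^sub>C a z) \<le> norm z" for z
        using norm_le_onorm[OF a(1), of z] pos
        by (simp add: norm_scaleC norm_divide divide_le_eq mult.commute)
      have "(?\<alpha> * sqrt s)\<^sup>2 \<le> r\<^sup>2"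
        using a(4) pos diamond_sum_nonneg[OF a(2)] by (intro power_mono) auto
      then have "?\<alpha>\<^sup>2 * s \<le> r\<^sup>2"
        using diamond_sum_nonneg[OF a(2)] by (simp add: power_mult_distrib)
      then show "diamond_sum D nE nF (complex_of_real ?\<alpha> *\<^sub>C W) (r\<^sup>2)"
        using diamond_sum_scaleC[OF a(2), of "complex_of_real ?\<alpha>"] by (auto intro: diamond_sum_mono)
      show "U = (\<lambda>z. complex_of_real (1 / ?\<alpha>) *\<^sub>C a z) \<bullet>\<^sub>m complex_of_real ?\<alpha> *\<^sub>C W"
        using False by (simp add: act_scale[OF lin] act_scaleC[OF lin] scaleC_scaleC scaleC_one a(3))
    qed
  qed
qed

lemma l_norm_leI:
  assumes "bounded_clinear a" "\<And>z. norm (a z) \<le> \<alpha> * norm z" "0 \<le> \<alpha>" "diamond_sum D nE nF W s"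
  shows "nl (a \<bullet>\<^sub>m W) \<le> \<alpha> * sqrt s"
proof -
  have "onorm a \<le> \<alpha>" using assms by (intro onorm_bound)
  then show ?thesis
    using l_norm_le[OF assms(1,4)] mult_right_mono[of "onorm a" \<alpha> "sqrt s"] diamond_sum_nonneg[OF assms(4)]
    by simp
qed

lemma l_norm_act:
  assumes a: "bounded_clinear a"
  shows "nl (a \<bullet>\<^sub>m U) \<le> onorm a * nl U"
proof (rule at_right_bound[where f="\<lambda>\<epsilon>. onorm a * (nl U + \<epsilon>)"])
  show "((\<lambda>\<epsilon>. onorm a * (nl U + \<epsilon>)) \<longlongrightarrow> onorm a * nl U) (at_right 0)"
    by (auto intro!: tendsto_eq_intros)
  fix \<epsilon> :: real assume "0 < \<epsilon>"
  then obtain b W where b: "bounded_clinear b" "\<And>z. norm (b z) \<le> norm z"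
    "diamond_sum D nE nF W ((nl U + \<epsilon>)\<^sup>2)" "U = b \<bullet>\<^sub>m W"
    using l_norm_approx[of U "nl U + \<epsilon>"] by auto
  have "norm (a (b z)) \<le> onorm a * norm z" for z
    using norm_le_onorm[OF a, of "b z"] mult_left_mono[OF b(2) onorm_nonneg[OF a], of z] by simp
  then have "nl ((\<lambda>z. a (b z)) \<bullet>\<^sub>m W) \<le> onorm a * sqrt ((nl U + \<epsilon>)\<^sup>2)"
    by (intro l_norm_leI bounded_clinear_comp[OF a b(1)] b(3) onorm_nonneg[OF a])
  then show "nl (a \<bullet>\<^sub>m U) \<le> onorm a * (nl U + \<epsilon>)"
    using \<open>0 < \<epsilon>\<close> l_norm_nonneg[of U] a b(1)
    by (simp add: b(4) act_act bounded_clinear_clinear)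
qed

lemma l_norm_zero: "nl 0 = 0"
  using l_norm_le[OF bounded_clinear_ident diamond_sum_zero[of 0]] l_norm_nonneg[of 0]
  by (simp add: act_ident)

text \<open>Scalar multiplication is the action of a multiple of the identity, which gives one
  inequality; the other is the same one for \<open>inverse c\<close>.\<close>

lemma l_norm_scaleC: "nl (c *\<^sub>C U) = cmod c * nl U"
proof -
  have le: "nl (c *\<^sub>C U) \<le> cmod c * nl U" for c U
  proof -
    have "nl ((\<lambda>z. c *\<^sub>C z) \<bullet>\<^sub>m U) \<le> onorm (\<lambda>z::'h. c *\<^sub>C z) * nl U"
      by (intro l_norm_act bounded_clinear_scale bounded_clinear_ident)
    also have "\<dots> \<le> cmod c * nl U"
      by (intro mult_right_mono l_norm_nonneg onorm_bound) (simp_all add: norm_scaleC)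
    finally show ?thesis by (simp add: act_scale clinear_ident act_ident)
  qed
  show ?thesis
  proof (cases "c = 0")
    case True
    then show ?thesis by (simp add: l_norm_zero)
  next
    case False
    have "nl U = nl (inverse c *\<^sub>C c *\<^sub>C U)" using False by (simp add: scaleC_scaleC scaleC_one)
    also have "\<dots> \<le> cmod (inverse c) * nl (c *\<^sub>C U)" by (rule le)
    finally have "cmod c * nl U \<le> nl (c *\<^sub>C U)" using False by (simp add: norm_divide field_simps)
    with le[of c U] show ?thesis by simp
  qed
qed

lemma l_norm_triangle: "nl (U + V) \<le> nl U + nl V"
proof (rule at_right_bound[where f="\<lambda>\<epsilon>. (nl U + \<epsilon>) + (nl V + \<epsilon>)"])
  show "((\<lambda>\<epsilon>. (nl U + \<epsilon>) + (nl V + \<epsilon>)) \<longlongrightarrow> nl U + nl V) (at_right 0)"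
    by (auto intro!: tendsto_eq_intros)
  fix \<epsilon> :: real assume \<epsilon>: "0 < \<epsilon>"
  define p where "p = nl U + \<epsilon>"
  define q where "q = nl V + \<epsilon>"
  have pq: "0 < p" "0 < q" using \<epsilon> l_norm_nonneg[of U] l_norm_nonneg[of V] by (simp_all add: p_def q_def)
  obtain a W where a: "bounded_clinear a" "\<And>z. norm (a z) \<le> norm z"
    "diamond_sum D nE nF W (p\<^sup>2)" "U = a \<bullet>\<^sub>m W"
    using l_norm_approx[of U p] \<epsilon> by (auto simp: p_def)
  obtain b W' where b: "bounded_clinear b" "\<And>z. norm (b z) \<le> norm z"
    "diamond_sum D nE nF W' (q\<^sup>2)" "V = b \<bullet>\<^sub>m W'"
    using l_norm_approx[of V q] \<epsilon> by (auto simp: q_def)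
  let ?p = "complex_of_real (sqrt p)" and ?q = "complex_of_real (sqrt q)"
  \<comment> \<open>The scaling lowers the squared costs from \<open>p\<^sup>2\<close> and
    \<open>q\<^sup>2\<close> to \<open>p\<close> and \<open>q\<close>. The merged sum then costs
    \<open>sqrt (p + q)\<close>, the operator \<open>c\<close> has norm at most
    \<open>sqrt (p + q)\<close>, and the product is exactly \<open>p + q\<close>.\<close>
  have "diamond_sum D nE nF ((1 / ?p) *\<^sub>C W) p" "diamond_sum D nE nF ((1 / ?q) *\<^sub>C W') q"
    using diamond_sum_scaleC[OF a(3), of "1 / ?p"] diamond_sum_scaleC[OF b(3), of "1 / ?q"] pq
    by (simp_all add: norm_divide power_divide power2_eq_square[of p] power2_eq_square[of q])
  from diamond_sum_combine[OF this] obtain T1 T2 W'' where T: "bounded_clinear T1" "bounded_clinear T2"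
    "\<And>z. (norm (T1 z))\<^sup>2 + (norm (T2 z))\<^sup>2 \<le> (norm z)\<^sup>2"
    "diamond_sum D nE nF W'' (p + q)" "T1 \<bullet>\<^sub>m W'' = (1 / ?p) *\<^sub>C W" "T2 \<bullet>\<^sub>m W'' = (1 / ?q) *\<^sub>C W'" by metis
  note lin = a(1)[THEN bounded_clinear_clinear] b(1)[THEN bounded_clinear_clinear]
    T(1,2)[THEN bounded_clinear_clinear]
  define c where "c z = ?p *\<^sub>C a (T1 z) + ?q *\<^sub>C b (T2 z)" for z
  have c: "bounded_clinear c"
    unfolding c_def[abs_def]
    by (rule bounded_clinear_plus[OF bounded_clinear_scale[OF bounded_clinear_comp[OF a(1) T(1)]]
          bounded_clinear_scale[OF bounded_clinear_comp[OF b(1) T(2)]]])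
  have "c \<bullet>\<^sub>m W'' = ?p *\<^sub>C (a \<bullet>\<^sub>m T1 \<bullet>\<^sub>m W'') + ?q *\<^sub>C (b \<bullet>\<^sub>m T2 \<bullet>\<^sub>m W'')"
    unfolding c_def[abs_def]
    by (simp add: act_plus clinear_scale clinear_comp lin act_scale act_act)
  also have "\<dots> = U + V"
    using pq by (simp add: T(5,6) act_scaleC lin scaleC_scaleC scaleC_one a(4) b(4))
  finally have cW: "c \<bullet>\<^sub>m W'' = U + V" .
  have "norm (c z) \<le> sqrt (p + q) * norm z" for z
  proof -
    let ?x = "norm (T1 z)" and ?y = "norm (T2 z)"
    have "norm (c z) \<le> sqrt p * norm (a (T1 z)) + sqrt q * norm (b (T2 z))"
      unfolding c_def using norm_triangle_ineq[of "?p *\<^sub>C a (T1 z)" "?q *\<^sub>C b (T2 z)"] pq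
      by (simp add: norm_scaleC)
    also have "\<dots> \<le> sqrt p * ?x + sqrt q * ?y"
      using pq by (intro add_mono mult_left_mono a b) auto
    finally have 1: "norm (c z) \<le> sqrt p * ?x + sqrt q * ?y" .
    \<comment> \<open>Lagrange's identity: this square is the difference of the two sides of the
      Cauchy-Schwarz estimate that follows.\<close>
    have "0 \<le> (sqrt p * ?y - sqrt q * ?x)\<^sup>2" by simp
    then have "(sqrt p * ?x + sqrt q * ?y)\<^sup>2 \<le> (p + q) * (?x\<^sup>2 + ?y\<^sup>2)"
      using pq by (simp add: power2_sum power2_diff power_mult_distrib algebra_simps)
    also have "\<dots> \<le> (p + q) * (norm z)\<^sup>2" using pq by (intro mult_left_mono T(3)) simp
    also have "\<dots> = (sqrt (p + q) * norm z)\<^sup>2" using pq by (simp add: power_mult_distrib)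
    finally have "sqrt p * ?x + sqrt q * ?y \<le> sqrt (p + q) * norm z"
      by (rule power2_le_imp_le) (use pq in simp)
    with 1 show ?thesis by simp
  qed
  then have "nl (c \<bullet>\<^sub>m W'') \<le> sqrt (p + q) * sqrt (p + q)"
    using pq by (intro l_norm_leI c T(4)) auto
  then show "nl (U + V) \<le> (nl U + \<epsilon>) + (nl V + \<epsilon>)"
    using pq by (simp add: cW p_def[symmetric] q_def[symmetric])
qed

lemma l_norm_orthogonal:
  assumes P: "is_support P U" and Q: "is_support Q V" and PQ: "orthogonal_projections P Q"
  shows "(nl (U + V))\<^sup>2 \<le> (nl U)\<^sup>2 + (nl V)\<^sup>2"
proof (rule at_right_bound[where f="\<lambda>\<epsilon>. (nl U + \<epsilon>)\<^sup>2 + (nl V + \<epsilon>)\<^sup>2"])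
  show "((\<lambda>\<epsilon>. (nl U + \<epsilon>)\<^sup>2 + (nl V + \<epsilon>)\<^sup>2) \<longlongrightarrow> (nl U)\<^sup>2 + (nl V)\<^sup>2) (at_right 0)"
    by (auto intro!: tendsto_eq_intros)
  fix \<epsilon> :: real assume \<epsilon>: "0 < \<epsilon>"
  define p where "p = nl U + \<epsilon>"
  define q where "q = nl V + \<epsilon>"
  obtain a W where a: "bounded_clinear a" "\<And>z. norm (a z) \<le> norm z"
    "diamond_sum D nE nF W (p\<^sup>2)" "U = a \<bullet>\<^sub>m W"
    using l_norm_approx[of U p] \<epsilon> by (auto simp: p_def)
  obtain b W' where b: "bounded_clinear b" "\<And>z. norm (b z) \<le> norm z"
    "diamond_sum D nE nF W' (q\<^sup>2)" "V = b \<bullet>\<^sub>m W'"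
    using l_norm_approx[of V q] \<epsilon> by (auto simp: q_def)
  obtain T1 T2 W'' where T: "bounded_clinear T1" "bounded_clinear T2"
    "\<And>z. (norm (T1 z))\<^sup>2 + (norm (T2 z))\<^sup>2 \<le> (norm z)\<^sup>2"
    "diamond_sum D nE nF W'' (p\<^sup>2 + q\<^sup>2)" "T1 \<bullet>\<^sub>m W'' = W" "T2 \<bullet>\<^sub>m W'' = W'"
    using diamond_sum_combine[OF a(3) b(3)] by metis
  have PQ': "orth_projection P" "orth_projection Q" "P \<bullet>\<^sub>m U = U" "Q \<bullet>\<^sub>m V = V"
    using P Q by (auto simp: is_support_def)
  then have bdd: "bounded_clinear P" "bounded_clinear Q" by (auto simp: orth_projection_def)
  note lin = a(1)[THEN bounded_clinear_clinear] b(1)[THEN bounded_clinear_clinear]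
    T(1,2)[THEN bounded_clinear_clinear] bdd[THEN bounded_clinear_clinear]
  \<comment> \<open>Inserting \<open>P\<close> and \<open>Q\<close> leaves \<open>U\<close> and
    \<open>V\<close> unchanged but makes the two ranges orthogonal. Hence \<open>c\<close> is a
    contraction and no rescaling of the sums is wanted.\<close>
  define c where "c z = P (a (T1 z)) + Q (b (T2 z))" for z
  have c: "bounded_clinear c"
    unfolding c_def[abs_def] 
    by (rule bounded_clinear_plus[OF bounded_clinear_comp[OF bdd(1) bounded_clinear_comp[OF a(1) T(1)]]
          bounded_clinear_comp[OF bdd(2) bounded_clinear_comp[OF b(1) T(2)]]])
  have "c \<bullet>\<^sub>m W'' = P \<bullet>\<^sub>m a \<bullet>\<^sub>m T1 \<bullet>\<^sub>m W'' + Q \<bullet>\<^sub>m b \<bullet>\<^sub>m T2 \<bullet>\<^sub>m W''"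
    unfolding c_def[abs_def]
      act_plus[OF clinear_comp[OF lin(5) clinear_comp[OF lin(1,3)]]
        clinear_comp[OF lin(6) clinear_comp[OF lin(2,4)]]]
    by (simp add: act_act clinear_comp lin)
  then have cW: "c \<bullet>\<^sub>m W'' = U + V" using a(4) b(4) T(5,6) PQ'(3,4) by simp
  have "norm (c z) \<le> 1 * norm z" for z
  proof -
    have "cinner (P x) (Q y) = 0" for x y
      using PQ PQ'(1)
      by (simp add: orth_projection_def orthogonal_projections_def fun_eq_iff cinner_zero_right)
    then have "(norm (c z))\<^sup>2 = (norm (P (a (T1 z))))\<^sup>2 + (norm (Q (b (T2 z))))\<^sup>2"
      unfolding c_def by (rule norm_add_orthogonal)
    also have "\<dots> \<le> (norm (T1 z))\<^sup>2 + (norm (T2 z))\<^sup>2"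
      using order_trans[OF norm_orth_projection_le[OF PQ'(1)] a(2)]
        order_trans[OF norm_orth_projection_le[OF PQ'(2)] b(2)]
      by (intro add_mono power_mono) auto
    also have "\<dots> \<le> (norm z)\<^sup>2" by (rule T(3))
    finally have "norm (c z) \<le> norm z" by (rule power2_le_imp_le) simp
    then show ?thesis by simp
  qed
  then have "nl (c \<bullet>\<^sub>m W'') \<le> 1 * sqrt (p\<^sup>2 + q\<^sup>2)"
    by (intro l_norm_leI c T(4)) auto
  then have "(nl (U + V))\<^sup>2 \<le> (sqrt (p\<^sup>2 + q\<^sup>2))\<^sup>2"
    by (intro power_mono l_norm_nonneg) (simp add: cW)
  then show "(nl (U + V))\<^sup>2 \<le> (nl U + \<epsilon>)\<^sup>2 + (nl V + \<epsilon>)\<^sup>2"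
    by (simp add: p_def q_def)
qed

lemma l_norm_diamond_tensor: "nl (diamond_tensor D u v) \<le> nE u * nF v"
proof -
  have "nl ((\<lambda>z. z) \<bullet>\<^sub>m diamond_tensor D u v) \<le> 1 * sqrt ((nE u)\<^sup>2 * (nF v)\<^sup>2)"
    by (intro l_norm_leI bounded_clinear_ident diamond_sum_single) auto
  then show ?thesis
    using PL_spaceD(1)[OF E] PL_spaceD(1)[OF F] by (simp add: act_ident real_sqrt_mult)
qed

end


section \<open>Definiteness\<close>

text \<open>The amplification of the functional \<open>f\<close>, with the tensor product of
  \<open>H\<close> and the complex numbers identified with \<open>H\<close>.\<close>

definition tens_eval :: "('e::complex_vector \<Rightarrow> complex) \<Rightarrow> ('h::complex_vector, 'e) tensor \<Rightarrow> 'h"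
  where "tens_eval f = tensor_lift (\<lambda>\<xi> x. f x *\<^sub>C \<xi>)"

text \<open>The slice map, which contracts the Hilbert space leg against \<open>w\<close>.\<close>

definition tens_slice :: "'h::complex_inner \<Rightarrow> ('h, 'e::complex_vector) tensor \<Rightarrow> 'e"
  where "tens_slice w = tensor_lift (\<lambda>\<xi> x. cinner \<xi> w *\<^sub>C x)"

lemma
  fixes f :: "'e::complex_vector \<Rightarrow> complex" and \<xi> :: "'h::complex_vector"
  assumes "clinear f"
  shows clinear_tens_eval: "clinear (tens_eval f :: ('h, 'e) tensor \<Rightarrow> 'h)"
    and tens_eval_tens: "tens_eval f (\<xi> \<otimes> x) = f x *\<^sub>C \<xi>"
proof -
  have "cbilinear (\<lambda>(\<xi>::'h) x. f x *\<^sub>C \<xi>)"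
    unfolding cbilinear_def
    by (intro conjI allI clinearI)
      (simp_all add: clinear_add[OF assms] clinear_scaleC[OF assms] scaleC_add_left scaleC_add_right
        scaleC_scaleC scaleC_complex_def mult.commute)
  then show "clinear (tens_eval f :: ('h, 'e) tensor \<Rightarrow> 'h)" "tens_eval f (\<xi> \<otimes> x) = f x *\<^sub>C \<xi>"
    by (simp_all add: tens_eval_def clinear_tensor_lift)
qed

lemma
  fixes w \<xi> :: "'h::complex_inner" and x :: "'e::complex_vector"
  shows clinear_tens_slice: "clinear (tens_slice w :: ('h, 'e) tensor \<Rightarrow> 'e)"
    and tens_slice_tens: "tens_slice w (\<xi> \<otimes> x) = cinner \<xi> w *\<^sub>C x"
proof -
  have "cbilinear (\<lambda>\<xi> (x::'e). cinner \<xi> w *\<^sub>C x)"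
    unfolding cbilinear_def
    by (intro conjI allI clinearI)
      (simp_all add: cinner_add_left cinner_scaleC_left scaleC_add_left scaleC_add_right
        scaleC_scaleC mult.commute)
  then show "clinear (tens_slice w :: ('h, 'e) tensor \<Rightarrow> 'e)" "tens_slice w (\<xi> \<otimes> x) = cinner \<xi> w *\<^sub>C x"
    by (simp_all add: tens_slice_def clinear_tensor_lift)
qed

text \<open>Both legs are contracted, in either order. Thus an inner product in \<open>H\<close>
  becomes a value of \<open>f\<close>, where a bound on \<open>f\<close> applies.\<close>

lemma cinner_tens_eval:
  assumes f: "clinear f"
  shows "cinner (tens_eval f u) w = f (tens_slice w u)"
proof (induction u rule: tens_induct)
  case zero
  show ?case by (simp add: clinear_zero[OF clinear_tens_eval[OF f]] clinear_zero[OF clinear_tens_slice]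
      clinear_zero[OF f] cinner_zero_left)
next
  case (add x y t)
  then show ?case
    by (simp add: clinear_add[OF clinear_tens_eval[OF f]] clinear_add[OF clinear_tens_slice]
      clinear_add[OF f] clinear_scaleC[OF f] tens_eval_tens[OF f] tens_slice_tens
      cinner_add_left cinner_scaleC_left scaleC_complex_def)
qed

lemma tens_eval_act:
  assumes "clinear f" "clinear a"
  shows "tens_eval f (a \<bullet>\<^sub>m u) = a (tens_eval f u)"
  by (rule clinear_tens_ext[OF clinear_comp[OF clinear_tens_eval clinear_act] clinear_comp[OF _ clinear_tens_eval]])
    (simp_all add: assms act_tens tens_eval_tens clinear_scaleC[OF assms(2)])

text \<open>Over a finite orthonormal basis carrying \<open>u\<close>, the tensor is the sum of the
  \<open>b \<otimes> tens_slice b u\<close>, so not all slices vanish.\<close>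

lemma tens_slice_nonzero:
  assumes "u \<noteq> (0 :: ('h::complex_hilbert, 'e::complex_vector) tensor)"
  obtains w where "tens_slice w u \<noteq> 0"
proof -
  obtain B where B: "orthonormal_on B (\<lambda>b. b)" "proj_op B (\<lambda>b. b) \<bullet>\<^sub>m u = u"
    using act_common_proj[of "{u}"] by auto
  have "proj_op B (\<lambda>b. b) \<bullet>\<^sub>m u = (\<Sum>b\<in>B. b \<otimes> tens_slice b u)"
    by (rule clinear_tens_ext[OF clinear_act[OF clinear_transfer_op]
          clinear_sum_fun[OF clinear_comp[OF clinear_tens(1) clinear_tens_slice]]])
      (simp add: act_tens clinear_transfer_op tens_slice_tens transfer_op_def tens_linear
        clinear_sum[OF clinear_tens(2)])
  then have "\<exists>b\<in>B. tens_slice b u \<noteq> 0"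
    using assms B(2) by (metis (no_types, lifting) sum.neutral tens_linear(5))
  then show ?thesis using that by blast
qed

text \<open>Functionals bounded in the norm \<open>x \<mapsto> \<parallel>e x\<parallel>\<close> are automatically \<open>L\<close>-contractive: with
  \<open>w = f\<^sub>\<infinity>(u)\<close>, apply the rank one operator \<open>\<xi> \<mapsto> \<langle>\<xi>, w\<rangle> e\<close> to \<open>u\<close>.\<close>

lemma norm_tens_eval_le:
  fixes n :: "('h::complex_hilbert, 'e::complex_vector) tensor \<Rightarrow> real"
  assumes n: "PL_space n" and e: "norm e = 1" and f: "clinear f" "\<And>x. cmod (f x) \<le> n (e \<otimes> x)"
  shows "norm (tens_eval f u) \<le> n u"
proof -
  let ?w = "tens_eval f u"
  define a where "a \<xi> = cinner \<xi> ?w *\<^sub>C e" for \<xi>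
  have lin: "clinear a" unfolding a_def[abs_def] by (intro clinear_scale_left clinear_cinner)
  have na: "norm (a \<xi>) \<le> norm ?w * norm \<xi>" for \<xi>
    using cmod_cinner_le[of \<xi> ?w] by (simp add: a_def norm_scaleC e mult.commute)
  have bdd: "bounded_clinear a" by (rule bounded_clinearI[OF lin na])
  have "a \<bullet>\<^sub>m u = e \<otimes> tens_slice ?w u"
    by (rule clinear_tens_ext[OF clinear_act[OF lin] clinear_comp[OF clinear_tens(1) clinear_tens_slice]])
      (simp add: act_tens lin a_def tens_slice_tens tens_linear)
  then have "n (e \<otimes> tens_slice ?w u) \<le> onorm a * n u" using PL_spaceD(5)[OF n bdd] by metis
  also have "\<dots> \<le> norm ?w * n u"
    by (intro mult_right_mono onorm_bound na PL_spaceD(1)[OF n]) simp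
  finally have 1: "n (e \<otimes> tens_slice ?w u) \<le> norm ?w * n u" .
  have "(norm ?w)\<^sup>2 = cmod (cinner ?w ?w)" by (simp add: cinner_self flip: of_real_power)
  also have "\<dots> = cmod (f (tens_slice ?w u))" by (simp add: cinner_tens_eval[OF f(1)])
  also have "\<dots> \<le> norm ?w * n u" using f(2) 1 by (rule order_trans)
  finally show ?thesis
    using PL_spaceD(1)[OF n, of u] by (cases "norm ?w = 0") (simp_all add: power2_eq_square)
qed

text \<open>Slicing by \<open>e\<close> recovers \<open>x\<close> from \<open>e \<otimes> x\<close>,
  whence definiteness. These norms on \<open>E\<close> and \<open>F\<close> are the ones fed to the
  Hahn-Banach theorem.\<close>

lemma is_norm_tens_unit:
  assumes n: "PL_space n" and e: "cinner e e = 1"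
  shows "is_norm (\<lambda>x. n (e \<otimes> x))"
proof -
  have "x = 0" if "e \<otimes> x = 0" for x
    using tens_slice_tens[of e e x] that
    by (simp add: e scaleC_one clinear_zero[OF clinear_tens_slice])
  then show ?thesis
    unfolding is_norm_def
    by (auto simp: PL_spaceD[OF n] tens_linear)
qed

text \<open>Through this identity, with \<open>cinner_D\<close>, orthogonality of the images of the
  first factors alone makes the images of the summands orthogonal.\<close>

lemma (in diamond_product) tens_eval_diamond_tensor:
  assumes "clinear f" "clinear g"
  shows "tens_eval (tens_functional f g) (diamond_tensor D u v) = D (tens_eval f u) (tens_eval g v)"
proof -
  note lin = clinear_tens_functional[OF assms]
  show ?thesis
    by (rule cbilinear_tens_ext[where s=u and t=v,
          OF cbilinear_compose[OF cbilinear_diamond_tensor clinear_ident clinear_ident clinear_tens_eval[OF lin]]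
            cbilinear_compose[OF cbilinear_D clinear_tens_eval clinear_tens_eval clinear_ident]])
      (simp_all add: assms diamond_tensor_tens[OF cbilinear_D] tens_eval_tens lin tens_functional_tens
        clinear_scaleC[OF D_linear(1)] clinear_scaleC[OF D_linear(2)] scaleC_scaleC mult.commute)
qed

context PL_tensor_product
begin

text \<open>A nonzero \<open>U\<close> has a nonzero slice in the tensor product of \<open>E\<close>
  and \<open>F\<close>, which some product functional \<open>h\<close> detects; so
  \<open>tens_eval h U\<close> is nonzero. But its norm is at most \<open>nl U\<close>.\<close>

lemma l_norm_eq_0:
  assumes "nl U = 0"
  shows "U = 0"
proof (rule ccontr)
  assume "U \<noteq> 0"
  then obtain w where w: "tens_slice w U \<noteq> 0" by (rule tens_slice_nonzero)
  obtain e :: 'h where e: "cinner e e = 1" "norm e = 1" by (rule unit_vector)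
  obtain f g where f: "clinear f" "\<And>x. cmod (f x) \<le> nE (e \<otimes> x)"
    and g: "clinear g" "\<And>y. cmod (g y) \<le> nF (e \<otimes> y)"
    and fg: "tens_functional f g (tens_slice w U) \<noteq> 0"
    using tens_functional_separates[OF is_norm_tens_unit[OF E e(1)] is_norm_tens_unit[OF F e(1)] w]
    by blast
  define h where "h = tens_functional f g"
  have h: "clinear h" unfolding h_def by (rule clinear_tens_functional[OF f(1) g(1)])
  \<comment> \<open>The summand 0 gives the shape expected by
    \<open>field_le_epsilon\<close>.\<close>
  have "norm (tens_eval h U) \<le> 0 + r" if r: "0 < r" for r
  proof -
    obtain a W where a: "bounded_clinear a" "\<And>z. norm (a z) \<le> norm z"
      "diamond_sum D nE nF W (r\<^sup>2)" "U = a \<bullet>\<^sub>m W"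
      using l_norm_approx[of U r] r assms by auto
    obtain n u v where W: "pairwise_orthogonal_supports n u"
      "W = (\<Sum>k = 1..n. diamond_tensor D (u k) (v k))"
      "(\<Sum>k = 1..n. (nE (u k))\<^sup>2 * (nF (v k))\<^sup>2) \<le> r\<^sup>2"
      using a(3) unfolding diamond_sum_def by blast
    obtain P where P: "\<And>k. k \<in> {1..n} \<Longrightarrow> is_support (P k) (u k)"
      "\<And>k l. k \<in> {1..n} \<Longrightarrow> l \<in> {1..n} \<Longrightarrow> k \<noteq> l \<Longrightarrow> orthogonal_projections (P k) (P l)"
      using W(1) unfolding pairwise_orthogonal_supports_def by blast
    \<comment> \<open>Evaluation commutes with the action, so \<open>P k\<close> fixes the image of
      \<open>u k\<close>, and orthogonal supports yield orthogonal vectors.\<close>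
    have orth: "cinner (tens_eval f (u k)) (tens_eval f (u l)) = 0"
      if kl: "k \<in> {1..n}" "l \<in> {1..n}" "k \<noteq> l" for k l
    proof -
      have *: "P k (tens_eval f (u k)) = tens_eval f (u k)" "orth_projection (P k)" if "k \<in> {1..n}" for k
        using P(1)[OF that] tens_eval_act[OF f(1), of "P k" "u k"]
        by (auto simp: is_support_def orth_projection_def bounded_clinear_clinear)
      have "cinner (tens_eval f (u k)) (tens_eval f (u l)) =
          cinner (P k (tens_eval f (u k))) (P l (tens_eval f (u l)))"
        by (simp only: *(1) kl)
      also have "\<dots> = cinner (tens_eval f (u k)) (P k (P l (tens_eval f (u l))))"
        using *(2)[OF kl(1)] by (simp add: orth_projection_def)
      also have "P k (P l (tens_eval f (u l))) = 0"
        using P(2)[OF kl] by (simp add: orthogonal_projections_def fun_eq_iff)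
      finally show ?thesis by (simp add: cinner_zero_right)
    qed
    have "(norm (tens_eval h U))\<^sup>2 \<le> (norm (tens_eval h W))\<^sup>2"
      using a(2) by (simp add: a(4) tens_eval_act[OF h bounded_clinear_clinear[OF a(1)]])
    also have "tens_eval h W = (\<Sum>k = 1..n. D (tens_eval f (u k)) (tens_eval g (v k)))"
      unfolding W(2) clinear_sum[OF clinear_tens_eval[OF h]]
      by (simp add: h_def tens_eval_diamond_tensor f g)
    also have "(norm \<dots>)\<^sup>2 = (\<Sum>k = 1..n. (norm (D (tens_eval f (u k)) (tens_eval g (v k))))\<^sup>2)"
      by (rule norm_sum_orthogonal) (simp_all add: cinner_D orth)
    also have "\<dots> \<le> (\<Sum>k = 1..n. (nE (u k))\<^sup>2 * (nF (v k))\<^sup>2)"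
      by (intro sum_mono)
        (simp add: norm_D power_mult_distrib mult_mono power_mono
          norm_tens_eval_le[OF E e(2) f] norm_tens_eval_le[OF F e(2) g])
    also have "\<dots> \<le> r\<^sup>2" by (rule W(3))
    finally have "norm (tens_eval h U) \<le> r" by (rule power2_le_imp_le) (use r in simp)
    then show ?thesis by simp
  qed
  then have "norm (tens_eval h U) \<le> 0" by (rule field_le_epsilon)
  then have "cinner (tens_eval h U) w = 0" by (simp add: cinner_zero_left)
  then show False using fg cinner_tens_eval[OF h, of U w] by (simp add: h_def)
qed

lemma PL_space_l_norm: "PL_space nl"
  unfolding PL_space_def is_norm_def
  using l_norm_nonneg l_norm_eq_0 l_norm_zero l_norm_triangle l_norm_scaleC l_norm_act by auto

lemma L_space_l_norm: "L_space nl"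
  unfolding L_space_def using PL_space_l_norm l_norm_orthogonal by blast

lemma L_contractive2_tens: "L_contractive2 D nE nF nl (\<otimes>)"
  unfolding L_contractive2_def
  using l_norm_diamond_tensor by (simp add: diamond_tensor_eq_amplify2)

end


section \<open>The universal property\<close>

text \<open>Induction on the number of summands. The partial sum is supported by the projection onto
  the span of the union of the finite bases, which is orthogonal to the next one.\<close>

lemma L_space_sum:
  assumes n: "L_space n" and w: "pairwise_orthogonal_supports m w"
  shows "(n (\<Sum>k = 1..m. w k))\<^sup>2 \<le> (\<Sum>k = 1..m. (n (w k))\<^sup>2)"
proof -
  obtain B where B: "\<And>k. k \<in> {1..m} \<Longrightarrow> orthonormal_on (B k) (\<lambda>b. b)"
      "\<And>k. k \<in> {1..m} \<Longrightarrow> proj_op (B k) (\<lambda>b. b) \<bullet>\<^sub>m w k = w k"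
      "\<And>k l b c. k \<in> {1..m} \<Longrightarrow> l \<in> {1..m} \<Longrightarrow> k \<noteq> l \<Longrightarrow> b \<in> B k \<Longrightarrow> c \<in> B l \<Longrightarrow> cinner b c = 0"
    using pairwise_orthogonal_supports_proj[OF w] by blast
  have PL: "PL_space n" using n by (simp add: L_space_def)
  have "j \<le> m \<Longrightarrow> (n (\<Sum>k = 1..j. w k))\<^sup>2 \<le> (\<Sum>k = 1..j. (n (w k))\<^sup>2)" for j
  proof (induction j)
    case 0
    show ?case using PL_spaceD(2)[OF PL, of 0] by simp
  next
    case (Suc j)
    define C where "C = (\<Union>k\<in>{1..j}. B k)"
    have C: "orthonormal_on C (\<lambda>b. b)"
      unfolding orthonormal_on_def
    proof (intro conjI ballI)
      show "finite C" using B(1) Suc.prems by (auto simp: C_def orthonormal_on_def)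
      fix b c assume "b \<in> C" "c \<in> C"
      then obtain k l where "k \<in> {1..m}" "l \<in> {1..m}" "b \<in> B k" "c \<in> B l"
        using Suc.prems by (force simp: C_def)
      \<comment> \<open>A vector common to two different blocks would be orthogonal to
        itself.\<close>
      then show "cinner b c = (if b = c then 1 else 0)"
        using B(1)[of k] B(3)[of k l b c]
        by (cases "k = l") (auto simp: orthonormal_on_def dest: cinner_eq_0_self)
    qed
    have "proj_op C (\<lambda>b. b) \<bullet>\<^sub>m w k = w k" if k: "k \<in> {1..j}" for k
    proof -
      have km: "k \<in> {1..m}" using k Suc.prems by auto
      have "(\<lambda>z. proj_op C (\<lambda>b. b) (proj_op (B k) (\<lambda>b. b) z)) = proj_op (B k) (\<lambda>b. b)"
      proof
        fix z
        have "proj_op (B k) (\<lambda>b. b) z \<in> cspan C"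
          unfolding transfer_op_def using k
          by (intro complex_vector.span_sum complex_vector.span_scale complex_vector.span_base)
            (auto simp: C_def)
        then show "proj_op C (\<lambda>b. b) (proj_op (B k) (\<lambda>b. b) z) = proj_op (B k) (\<lambda>b. b) z"
          by (rule proj_op_span[OF C])
      qed
      then show ?thesis
        using act_act[OF clinear_transfer_op clinear_transfer_op, of C "\<lambda>b. b" "\<lambda>b. b" "B k" "\<lambda>b. b" "\<lambda>b. b" "w k"]
        by (simp add: B(2)[OF km])
    qed
    then have "is_support (proj_op C (\<lambda>b. b)) (\<Sum>k = 1..j. w k)"
      by (simp add: is_support_def orth_projection_proj_op[OF C] clinear_sum[OF clinear_act[OF clinear_transfer_op]])
    moreover have "is_support (proj_op (B (Suc j)) (\<lambda>b. b)) (w (Suc j))"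
      using B(1,2)[of "Suc j"] Suc.prems by (simp add: is_support_def orth_projection_proj_op)
    moreover have "orthogonal_projections (proj_op C (\<lambda>b. b)) (proj_op (B (Suc j)) (\<lambda>b. b))"
    proof (rule orthogonal_projections_proj_op)
      fix b c assume "b \<in> C" "c \<in> B (Suc j)"
      then obtain k where "k \<in> {1..j}" "b \<in> B k" by (auto simp: C_def)
      then show "cinner c b = 0" using \<open>c \<in> B (Suc j)\<close> Suc.prems by (intro B(3)[of "Suc j" k]) auto
    qed
    ultimately have "(n ((\<Sum>k = 1..j. w k) + w (Suc j)))\<^sup>2 \<le> (n (\<Sum>k = 1..j. w k))\<^sup>2 + (n (w (Suc j)))\<^sup>2"
      using n unfolding L_space_def by blast
    with Suc show ?case by simp
  qed
  then show ?thesis by simp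
qed

context diamond_product
begin

text \<open>The products of \<open>B k\<close> with one basis \<open>Y\<close> for all second
  factors are supports. Inner products of \<open>D b y\<close> and \<open>D c y'\<close> factor, and
  the factor from \<open>b\<close> and \<open>c\<close> vanishes for different blocks.\<close>

lemma pairwise_orthogonal_supports_amplify2:
  fixes u :: "nat \<Rightarrow> ('h, 'a::complex_vector) tensor" and v :: "nat \<Rightarrow> ('h, 'b::complex_vector) tensor"
  assumes R: "cbilinear R" and u: "pairwise_orthogonal_supports n u"
  shows "pairwise_orthogonal_supports n (\<lambda>k. amplify2 D R (u k) (v k))"
proof -
  obtain B where B: "\<And>k. k \<in> {1..n} \<Longrightarrow> orthonormal_on (B k) (\<lambda>b. b)"
      "\<And>k. k \<in> {1..n} \<Longrightarrow> proj_op (B k) (\<lambda>b. b) \<bullet>\<^sub>m u k = u k"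
      "\<And>k l b c. k \<in> {1..n} \<Longrightarrow> l \<in> {1..n} \<Longrightarrow> k \<noteq> l \<Longrightarrow> b \<in> B k \<Longrightarrow> c \<in> B l \<Longrightarrow> cinner b c = 0"
    using pairwise_orthogonal_supports_proj[OF u] by blast
  obtain Y where Y: "orthonormal_on Y (\<lambda>b. b)" "\<And>k. k \<in> {1..n} \<Longrightarrow> proj_op Y (\<lambda>b. b) \<bullet>\<^sub>m v k = v k"
    using act_common_proj[of "v ` {1..n}"] by auto
  define P where "P k = proj_op (B k \<times> Y) (\<lambda>(x, y). D x y)" for k
  have "is_support (P k) (amplify2 D R (u k) (v k))" if "k \<in> {1..n}" for k
    using transfer_op_amplify2[OF R, of "B k" Y "\<lambda>b. b" "\<lambda>b. b" "\<lambda>b. b" "\<lambda>b. b" "u k" "v k"]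
      orthonormal_D[OF B(1)[OF that] Y(1)]
    by (simp add: is_support_def P_def orth_projection_proj_op B(2)[OF that] Y(2)[OF that])
  moreover have "orthogonal_projections (P k) (P l)" if "k \<in> {1..n}" "l \<in> {1..n}" "k \<noteq> l" for k l
    unfolding P_def using B(3)[OF that(2,1)] that(3)
    by (intro orthogonal_projections_proj_op) (auto simp: cinner_D)
  ultimately show ?thesis unfolding pairwise_orthogonal_supports_def by blast
qed

end

locale L_bounded_bilinear = PL_tensor_product D nE nF
  for D :: "'h::complex_hilbert \<Rightarrow> 'h \<Rightarrow> 'h"
    and nE :: "('h, 'e::complex_vector) tensor \<Rightarrow> real"
    and nF :: "('h, 'f::complex_vector) tensor \<Rightarrow> real" +
  fixes nG :: "('h, 'g::complex_vector) tensor \<Rightarrow> real" and B :: "'e \<Rightarrow> 'f \<Rightarrow> 'g"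
  assumes G: "L_space nG" and B: "cbilinear B" and bounded: "L_bounded2 D nE nF nG B"
begin

abbreviation \<kappa> :: real
  where "\<kappa> \<equiv> lb_norm2 D nE nF nG B"

lemma PL_G: "PL_space nG"
  using G by (simp add: L_space_def)

lemma lb_norm2_nonneg: "0 \<le> \<kappa>"
  and amplify2_le_lb_norm2: "nG (amplify2 D B u v) \<le> \<kappa> * nE u * nF v"
proof -
  note bil = cbilinear_amplify2[OF cbilinear_D B]
  note lin = cbilinearD[OF bil]
  let ?A = "{nG (amplify2 D B u v) | u v. nE u \<le> 1 \<and> nF v \<le> 1}"
  obtain K where K: "\<And>u v. nG (amplify2 D B u v) \<le> K * nE u * nF v"
    using bounded unfolding L_bounded2_def by blast
  \<comment> \<open>A real \<open>Sup\<close> bounds its set only when that set is bounded above.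
    The absolute value occurs since \<open>K\<close> may be negative, for instance if
    \<open>E\<close> is zero.\<close>
  have bdd: "bdd_above ?A"
  proof (rule bdd_aboveI)
    fix x assume "x \<in> ?A"
    then obtain u v where x: "x = nG (amplify2 D B u v)" "nE u \<le> 1" "nF v \<le> 1" by blast
    have "x \<le> \<bar>K\<bar> * (nE u * nF v)"
      using K[of u v]
        mult_right_mono[OF abs_ge_self[of K] mult_nonneg_nonneg[OF PL_spaceD(1)[OF E] PL_spaceD(1)[OF F]], of u v]
      by (simp add: x(1) mult.assoc)
    also have "\<dots> \<le> \<bar>K\<bar> * (1 * 1)"
      using x PL_spaceD(1)[OF E] PL_spaceD(1)[OF F] by (intro mult_left_mono mult_mono) auto
    finally show "x \<le> \<bar>K\<bar>" by simp
  qed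
  have up: "nG (amplify2 D B u v) \<le> \<kappa>" if "nE u \<le> 1" "nF v \<le> 1" for u v
    unfolding lb_norm2_def using that by (intro cSup_upper bdd) blast
  show "0 \<le> \<kappa>"
    using up[of 0 0] PL_spaceD(2)[OF E, of 0] PL_spaceD(2)[OF F, of 0] PL_spaceD(1)[OF PL_G]
    by (metis order_trans zero_le_one)
  show "nG (amplify2 D B u v) \<le> \<kappa> * nE u * nF v"
  proof (cases "u = 0 \<or> v = 0")
    case True
    then have "amplify2 D B u v = 0" using clinear_zero[OF lin(1)] clinear_zero[OF lin(2)] by metis
    then show ?thesis
      using True PL_spaceD(2)[OF E, of 0] PL_spaceD(2)[OF F, of 0] PL_spaceD(2)[OF PL_G, of 0] by auto
  next
    case False
    then have pos: "0 < nE u" "0 < nF v"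
      using PL_spaceD(1,2)[OF E, of u] PL_spaceD(1,2)[OF F, of v] by (auto simp: less_le)
    have "nG (amplify2 D B (complex_of_real (1 / nE u) *\<^sub>C u) (complex_of_real (1 / nF v) *\<^sub>C v)) \<le> \<kappa>"
      using pos by (intro up) (simp_all add: PL_spaceD(4)[OF E] PL_spaceD(4)[OF F] norm_divide)
    then show ?thesis
      using pos by (simp add: clinear_scaleC[OF lin(1)] clinear_scaleC[OF lin(2)]
          PL_spaceD(4)[OF PL_G] norm_divide norm_mult field_simps)
  qed
qed

lemma amplify_diamond_tensor:
  assumes "clinear R" "\<And>x y. R (x \<otimes> y) = B x y"
  shows "amplify R (diamond_tensor D u v) = amplify2 D B u v"
  by (rule cbilinear_tens_ext[where s=u and t=v,
        OF cbilinear_compose[OF cbilinear_diamond_tensor clinear_ident clinear_ident clinear_amplify[OF assms(1)]]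
          cbilinear_amplify2[OF cbilinear_D B]])
    (simp add: diamond_tensor_tens[OF cbilinear_D] amplify_tens assms amplify2_tens[OF cbilinear_D B])

text \<open>The module inequality in \<open>G\<close> absorbs the contraction, and the
  \<open>L\<close>-space inequality leaves a sum of squares that matches the cost of the
  representation term by term. The constant is therefore \<open>\<kappa>\<close> itself, as the
  equality of norms demands.\<close>

lemma amplify_le_l_norm:
  assumes R: "clinear R" "\<And>x y. R (x \<otimes> y) = B x y"
  shows "nG (amplify R U) \<le> \<kappa> * nl U"
proof (rule at_right_bound[where f="\<lambda>\<epsilon>. \<kappa> * (nl U + \<epsilon>)"])
  show "((\<lambda>\<epsilon>. \<kappa> * (nl U + \<epsilon>)) \<longlongrightarrow> \<kappa> * nl U) (at_right 0)"
    by (auto intro!: tendsto_eq_intros)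
  fix \<epsilon> :: real assume "0 < \<epsilon>"
  define r where "r = nl U + \<epsilon>"
  have r: "0 < r" using \<open>0 < \<epsilon>\<close> l_norm_nonneg[of U] by (simp add: r_def)
  obtain a W where a: "bounded_clinear a" "\<And>z. norm (a z) \<le> norm z"
    "diamond_sum D nE nF W (r\<^sup>2)" "U = a \<bullet>\<^sub>m W"
    using l_norm_approx[of U r] \<open>0 < \<epsilon>\<close> by (auto simp: r_def)
  obtain n u v where W: "pairwise_orthogonal_supports n u"
    "W = (\<Sum>k = 1..n. diamond_tensor D (u k) (v k))"
    "(\<Sum>k = 1..n. (nE (u k))\<^sup>2 * (nF (v k))\<^sup>2) \<le> r\<^sup>2"
    using a(3) unfolding diamond_sum_def by blast
  have "nG (amplify R U) \<le> onorm a * nG (amplify R W)"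
    using PL_spaceD(5)[OF PL_G a(1)] by (simp add: a(4) amplify_act R(1) bounded_clinear_clinear[OF a(1)])
  also have "\<dots> \<le> 1 * nG (amplify R W)"
    using a(2) by (intro mult_right_mono PL_spaceD(1)[OF PL_G] onorm_bound) auto
  finally have 1: "nG (amplify R U) \<le> nG (amplify R W)" by simp
  have "amplify R W = (\<Sum>k = 1..n. amplify2 D B (u k) (v k))"
    unfolding W(2) clinear_sum[OF clinear_amplify[OF R(1)]] by (simp add: amplify_diamond_tensor R)
  then have "(nG (amplify R W))\<^sup>2 \<le> (\<Sum>k = 1..n. (nG (amplify2 D B (u k) (v k)))\<^sup>2)"
    using L_space_sum[OF G pairwise_orthogonal_supports_amplify2[OF B W(1), of v]] by simp
  also have "\<dots> \<le> (\<Sum>k = 1..n. (\<kappa> * nE (u k) * nF (v k))\<^sup>2)"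
    by (intro sum_mono power_mono amplify2_le_lb_norm2 PL_spaceD(1)[OF PL_G])
  also have "\<dots> = \<kappa>\<^sup>2 * (\<Sum>k = 1..n. (nE (u k))\<^sup>2 * (nF (v k))\<^sup>2)"
    by (simp add: sum_distrib_left power_mult_distrib mult.assoc)
  also have "\<dots> \<le> \<kappa>\<^sup>2 * r\<^sup>2" by (intro mult_left_mono W(3)) simp
  also have "\<dots> = (\<kappa> * r)\<^sup>2" by (simp add: power_mult_distrib)
  finally have "nG (amplify R W) \<le> \<kappa> * r"
    by (rule power2_le_imp_le) (use r lb_norm2_nonneg in simp)
  with 1 show "nG (amplify R U) \<le> \<kappa> * (nl U + \<epsilon>)" by (simp add: r_def)
qed

text \<open>For the lower bound: \<open>\<diamondsuit>\<close> maps pairs from the two unit balls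
  into the unit ball of \<open>nl\<close>, and there the amplification of \<open>R\<close> takes the
  values of the amplified \<open>B\<close>.\<close>

lemma lb_norm_eq:
  assumes R: "clinear R" "\<And>x y. R (x \<otimes> y) = B x y"
  shows "lb_norm nl nG R = \<kappa>"
proof (rule antisym)
  let ?A = "{nG (amplify R U) | U. nl U \<le> 1}"
  have up: "x \<le> \<kappa>" if "x \<in> ?A" for x
  proof -
    from that obtain U where U: "x = nG (amplify R U)" "nl U \<le> 1" by blast
    then show ?thesis
      using amplify_le_l_norm[OF R, of U] mult_left_mono[OF U(2) lb_norm2_nonneg] by simp
  qed
  show "lb_norm nl nG R \<le> \<kappa>"
    unfolding lb_norm_def using l_norm_zero by (intro cSup_least up) (auto intro: exI[of _ 0])
  show "\<kappa> \<le> lb_norm nl nG R"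
    unfolding lb_norm2_def
  proof (rule cSup_least)
    show "{nG (amplify2 D B u v) | u v. nE u \<le> 1 \<and> nF v \<le> 1} \<noteq> {}"
    proof -
      have "nE 0 \<le> 1" "nF 0 \<le> 1"
        using PL_spaceD(2)[OF E, of 0] PL_spaceD(2)[OF F, of 0] by simp_all
      then show ?thesis by blast
    qed
    fix x assume "x \<in> {nG (amplify2 D B u v) | u v. nE u \<le> 1 \<and> nF v \<le> 1}"
    then obtain u v where "x = nG (amplify2 D B u v)" and uv: "nE u \<le> 1" "nF v \<le> 1" by blast
    then have x: "x = nG (amplify R (diamond_tensor D u v))" by (simp add: amplify_diamond_tensor[OF R])
    have "nl (diamond_tensor D u v) \<le> 1"
      using l_norm_diamond_tensor[of u v] mult_mono[OF uv] PL_spaceD(1)[OF F, of v] by simp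
    then have "x \<in> ?A" using x by blast
    then show "x \<le> lb_norm nl nG R"
      unfolding lb_norm_def using up by (intro cSup_upper bdd_aboveI[of _ \<kappa>])
  qed
qed

text \<open>Boundedness of the algebraic linearization is \<open>amplify_le_l_norm\<close>;
  uniqueness holds because elementary tensors span.\<close>

lemma ex1_linearization:
  "\<exists>!R. clinear R \<and> L_bounded nl nG R \<and> (\<forall>x y. R (x \<otimes> y) = B x y)"
proof (rule ex1I)
  let ?R = "tensor_lift B"
  have "L_bounded nl nG ?R"
    unfolding L_bounded_def using amplify_le_l_norm[OF clinear_tensor_lift[OF B]] B by auto
  then show "clinear ?R \<and> L_bounded nl nG ?R \<and> (\<forall>x y. ?R (x \<otimes> y) = B x y)"
    by (simp add: B clinear_tensor_lift)
  fix R assume "clinear R \<and> L_bounded nl nG R \<and> (\<forall>x y. R (x \<otimes> y) = B x y)"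
  then show "R = ?R"
    using clinear_tens_ext[of R ?R] by (auto simp: B clinear_tensor_lift)
qed

end

text \<open>Two linearly independent vectors exist, and an orthonormal family spanning both cannot
  consist of a single vector.\<close>

lemma orthonormal_pair_exists:
  assumes "\<not> (\<exists>S :: 'h::complex_inner set. finite S \<and> cspan S = UNIV)"
  shows "\<exists>e :: bool \<Rightarrow> 'h. orthonormal_on UNIV e"
proof -
  obtain x :: 'h where x: "x \<notin> cspan {}" using assms by blast
  obtain y where y: "y \<notin> cspan {x}" using assms by blast
  obtain B where B: "orthonormal_on B (\<lambda>b. b)" "{x, y} \<subseteq> cspan B"
    using gram_schmidt[of "{x, y}"] by blast
  have "\<exists>b c. b \<in> B \<and> c \<in> B \<and> b \<noteq> c"
  proof (rule ccontr)
    assume "\<not> ?thesis"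
    then obtain b where "B \<subseteq> {b}" by blast
    then have "x \<in> cspan {b}" "y \<in> cspan {b}" using B(2) complex_vector.span_mono by blast+
    then obtain k l where kl: "x = k *\<^sub>C b" "y = l *\<^sub>C b"
      by (auto simp: complex_vector.span_singleton)
    then have "k \<noteq> 0" using x by auto
    then have "y = (l / k) *\<^sub>C x" by (simp add: kl scaleC_scaleC)
    then show False using y by (auto simp: complex_vector.span_singleton)
  qed
  then obtain b c where bc: "b \<in> B" "c \<in> B" "b \<noteq> c" by blast
  then show ?thesis
    using B(1) by (intro exI[of _ "\<lambda>i. if i then b else c"]) (auto simp: orthonormal_on_def)
qed

theorem theorem6p11:
  fixes J :: "('h::complex_hilbert, 'h) tensor \<Rightarrow> 'k::complex_hilbert"
    and \<iota> :: "'k \<Rightarrow> 'h"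
    and nE :: "('h, 'e::complex_vector) tensor \<Rightarrow> real"
    and nF :: "('h, 'f::complex_vector) tensor \<Rightarrow> real"
  assumes separable: "separable_space (euclidean :: 'h topology)"
    and infinite_dimensional: "\<not> (\<exists>S :: 'h set. finite S \<and> cspan S = UNIV)"
    and J: "hilbert_tensor_product J"
    and \<iota>: "unitary_iso \<iota>"
    and E: "PL_space nE"
    and F: "PL_space nF"
  shows "L_space (l_norm (diamond J \<iota>) nE nF)
    \<and> L_contractive2 (diamond J \<iota>) nE nF (l_norm (diamond J \<iota>) nE nF) (\<otimes>)
    \<and> (\<forall>(nG :: ('h, 'g::complex_vector) tensor \<Rightarrow> real) (B :: 'e \<Rightarrow> 'f \<Rightarrow> 'g).
        L_space nG \<and> cbilinear B \<and> L_bounded2 (diamond J \<iota>) nE nF nG B \<longrightarrow>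
        (\<exists>!R. clinear R \<and> L_bounded (l_norm (diamond J \<iota>) nE nF) nG R
            \<and> (\<forall>x y. R (x \<otimes> y) = B x y)) \<and>
        (\<forall>R. clinear R \<and> L_bounded (l_norm (diamond J \<iota>) nE nF) nG R
            \<and> (\<forall>x y. R (x \<otimes> y) = B x y) \<longrightarrow>
          lb_norm (l_norm (diamond J \<iota>) nE nF) nG R = lb_norm2 (diamond J \<iota>) nE nF nG B))"
proof -
  interpret PL_tensor_product "diamond J \<iota>" nE nF
  proof
    show "cbilinear (diamond J \<iota>)"
      using J \<iota> by (intro cbilinear_diamond) (auto simp: hilbert_tensor_product_def unitary_iso_def)
    show "cinner (diamond J \<iota> \<xi> \<eta>) (diamond J \<iota> \<xi>' \<eta>') = cinner \<xi> \<xi>' * cinner \<eta> \<eta>'" for \<xi> \<eta> \<xi>' \<eta>'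
      using J \<iota> by (simp add: hilbert_tensor_product_def unitary_iso_def diamond_def)
  qed (use orthonormal_pair_exists[OF infinite_dimensional] E F in auto)
  show ?thesis
  proof (intro conjI allI impI; (elim conjE)?)
    fix nG :: "('h, 'g) tensor \<Rightarrow> real" and B :: "'e \<Rightarrow> 'f \<Rightarrow> 'g"
    assume "L_space nG" "cbilinear B" "L_bounded2 (diamond J \<iota>) nE nF nG B"
    then interpret L_bounded_bilinear "diamond J \<iota>" nE nF nG B by unfold_locales
    show "\<exists>!R. clinear R \<and> L_bounded nl nG R \<and> (\<forall>x y. R (x \<otimes> y) = B x y)"
      by (rule ex1_linearization)
    show "lb_norm nl nG R = \<kappa>" if "clinear R" "\<forall>x y. R (x \<otimes> y) = B x y" for R
      using that by (intro lb_norm_eq) auto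
  qed (rule L_space_l_norm L_contractive2_tens)+
qed

end
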